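(* Let $G \in \mathscr{L}$ be a strongly topological gyrogroup and let $H$ be a strong subgyrogroup of $G$ such that the quotient space $G/H$ is Hausdorff. Then every compact $G_\delta$-set in the quotient space $G/H$ is Dugundji.
   Context: All topological spaces are assumed to be Hausdorff. $\mathscr{L}$ denotes a class of Lindelöf spaces that is closed under finite products (so if $X,Y\in\mathscr{L}$ then $X\times Y\in\mathscr{L}$; in particular, all finite powers of a member of $\mathscr{L}$ are Lindelöf). A gyrogroup is a set $G$ with a binary operation $\oplus$ such that: (G1) there is a unique identity element $0\in G$ with $0\oplus a=a=a\oplus 0$ for all $a\in G$; (G2) for each $x\in G$ there is a unique inverse $\ominus x\in G$ with $\ominus x\oplus x=0=x\oplus(\ominus x)$; (G3) for all $x,y\in G$ there is an automorphism $\mathrm{gyr}[x,y]\in \mathrm{Aut}(G,\oplus)$ with $x\oplus(y\oplus z)=(x\oplus y)\oplus \mathrm{gyr}[x,y](z)$ for all $z\in G$; (G4) $\mathrm{gyr}[x\oplus y,y]=\mathrm{gyr}[x,y]$ for all $x,y\in G$. A topological gyrogroup is a gyrogroup $G$ with a topology such that $\oplus:G\times G\to G$ is (jointly) continuous and $x\mapsto\ominus x$ is continuous. A topological gyrogroup $G$ is a strongly topological gyrogroup if there is a neighborhood base $\mathscr{U}$ at $0$ such that $\mathrm{gyr}[x,y](U)=U$ for all $U\in\mathscr{U}$ and all $x,y\in G$ (one may assume each $U\in\mathscr U$ is symmetric, $\ominus U=U$). A nonempty subset $H\subseteq G$ is a subgyrogroup if $\oplus$ restricts to a binary operation on $H$,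 $H$ is a gyrogroup under it, and for all $x,y\in H$ the restriction $\mathrm{gyr}[x,y]|_H:H\to\mathrm{gyr}[x,y](H)$ is a bijective homomorphism. A subgyrogroup $H$ is a strong subgyrogroup if $\mathrm{gyr}[x,y](H)=H$ for all $x,y\in G$. In that case the left cosets $a\oplus H$, $a\in G$, form a partition of $G$, and $G/H$ denotes the set of left cosets with the quotient topology induced by the map $G\to G/H$, $a\mapsto a\oplus H$. A $G_\delta$-set is a countable intersection of open sets. A compact space $X$ is Dugundji if for every zero-dimensional compact space $Z$, every closed subset $A$ of $Z$ and every continuous mapping $f:A\to X$, there exists a continuous mapping $g:Z\to X$ extending $f$. *)

theory Defs
  imports "HOL-Analysis.Analysis"
begin

section \<open>Gyrogroups\<close>

text \<open>
  The gyrogroup lives on a carrier set \<open>G\<close>. The values of the operations outside \<open>G\<close> are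
  irrelevant, so equality of gyrations is stated pointwise on \<open>G\<close>.
\<close>

locale gyrogroup =
  fixes G :: "'a set"
    and add :: "'a \<Rightarrow> 'a \<Rightarrow> 'a"  (infixl "\<oplus>" 65)
    and zero :: 'a  ("\<zero>")
    and neg :: "'a \<Rightarrow> 'a"  ("\<ominus> _" [81] 80)
    and gyr :: "'a \<Rightarrow> 'a \<Rightarrow> 'a \<Rightarrow> 'a"
  assumes add_closed: "\<lbrakk>x \<in> G; y \<in> G\<rbrakk> \<Longrightarrow> x \<oplus> y \<in> G"
    and zero_closed: "\<zero> \<in> G"
    and zero_identity: "a \<in> G \<Longrightarrow> \<zero> \<oplus> a = a \<and> a \<oplus> \<zero> = a"
    and zero_unique: "\<lbrakk>e \<in> G; \<And>a. a \<in> G \<Longrightarrow> e \<oplus> a = a \<and> a \<oplus> e = a\<rbrakk> \<Longrightarrow> e = \<zero>"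
    and neg_closed: "x \<in> G \<Longrightarrow> \<ominus> x \<in> G"
    and neg_inverse: "x \<in> G \<Longrightarrow> \<ominus> x \<oplus> x = \<zero> \<and> x \<oplus> \<ominus> x = \<zero>"
    and neg_unique: "\<lbrakk>x \<in> G; y \<in> G; y \<oplus> x = \<zero>; x \<oplus> y = \<zero>\<rbrakk> \<Longrightarrow> y = \<ominus> x"
    and gyr_bij: "\<lbrakk>x \<in> G; y \<in> G\<rbrakk> \<Longrightarrow> bij_betw (gyr x y) G G"
    and gyr_hom: "\<lbrakk>x \<in> G; y \<in> G; u \<in> G; v \<in> G\<rbrakk>
          \<Longrightarrow> gyr x y (u \<oplus> v) = gyr x y u \<oplus> gyr x y v"
    and gyr_assoc: "\<lbrakk>x \<in> G; y \<in> G; z \<in> G\<rbrakk>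
          \<Longrightarrow> x \<oplus> (y \<oplus> z) = (x \<oplus> y) \<oplus> gyr x y z"
    and gyr_loop: "\<lbrakk>x \<in> G; y \<in> G; z \<in> G\<rbrakk> \<Longrightarrow> gyr (x \<oplus> y) y z = gyr x y z"

locale subgyrogroup = gyrogroup +
  fixes H :: "'a set"
  assumes sub_subset: "H \<subseteq> G"
    and sub_nonempty: "H \<noteq> {}"
    and sub_gyrogroup: "\<exists>zero' neg' gyr'. gyrogroup H add zero' neg' gyr'"
    and sub_gyr_bij: "\<lbrakk>x \<in> H; y \<in> H\<rbrakk> \<Longrightarrow> bij_betw (gyr x y) H (gyr x y ` H)"
    and sub_gyr_hom: "\<lbrakk>x \<in> H; y \<in> H; u \<in> H; v \<in> H\<rbrakk>
          \<Longrightarrow> gyr x y (u \<oplus> v) = gyr x y u \<oplus> gyr x y v"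

locale strong_subgyrogroup = subgyrogroup +
  assumes gyr_image_sub: "\<lbrakk>x \<in> G; y \<in> G\<rbrakk> \<Longrightarrow> gyr x y ` H = H"

section \<open>Topological gyrogroups\<close>

text \<open>All spaces are Hausdorff by convention; the carrier is the underlying set of the topology.\<close>

locale topological_gyrogroup = gyrogroup "topspace T" add zero neg gyr
  for T :: "'a topology"
    and add (infixl "\<oplus>" 65) and zero ("\<zero>") and neg ("\<ominus> _" [81] 80) and gyr +
  assumes Hausdorff: "Hausdorff_space T"
    and continuous_add: "continuous_map (prod_topology T T) T (\<lambda>(x, y). x \<oplus> y)"
    and continuous_neg: "continuous_map T T (\<lambda>x. \<ominus> x)"

text \<open>Members of a neighbourhood base are not required to be open.\<close>

definition neighbourhood_base :: "'a topology \<Rightarrow> 'a \<Rightarrow> 'a set set \<Rightarrow> bool" where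
  "neighbourhood_base T x \<U> \<longleftrightarrow>
     (\<forall>U\<in>\<U>. U \<subseteq> topspace T \<and> (\<exists>V. openin T V \<and> x \<in> V \<and> V \<subseteq> U)) \<and>
     (\<forall>W. openin T W \<and> x \<in> W \<longrightarrow> (\<exists>U\<in>\<U>. U \<subseteq> W))"

locale strongly_topological_gyrogroup = topological_gyrogroup +
  assumes gyr_invariant_base:
    "\<exists>\<U>. neighbourhood_base T \<zero> \<U> \<and>
         (\<forall>U\<in>\<U>. \<forall>x\<in>topspace T. \<forall>y\<in>topspace T. gyr x y ` U = U)"

section \<open>The space of left cosets\<close>

definition left_coset :: "('a \<Rightarrow> 'a \<Rightarrow> 'a) \<Rightarrow> 'a set \<Rightarrow> 'a \<Rightarrow> 'a set" where
  "left_coset add H a = add a ` H"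

definition coset_space :: "'a topology \<Rightarrow> ('a \<Rightarrow> 'a \<Rightarrow> 'a) \<Rightarrow> 'a set \<Rightarrow> 'a set topology" where
  "coset_space T add H =
     topology (\<lambda>\<V>. \<V> \<subseteq> left_coset add H ` topspace T \<and>
                   openin T {a \<in> topspace T. left_coset add H a \<in> \<V>})"

lemma openin_coset_space:
  "openin (coset_space T add H) \<V> \<longleftrightarrow>
     \<V> \<subseteq> left_coset add H ` topspace T \<and> openin T {a \<in> topspace T. left_coset add H a \<in> \<V>}"
proof -
  let ?q = "left_coset add H"
  let ?P = "\<lambda>\<V>. \<V> \<subseteq> ?q ` topspace T \<and> openin T {a \<in> topspace T. ?q a \<in> \<V>}"
  have "istopology ?P"
    unfolding istopology_def
  proof (intro conjI allI impI)
    fix S S' assume S: "?P S" and S': "?P S'"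
    have "{a \<in> topspace T. ?q a \<in> S \<inter> S'} =
        {a \<in> topspace T. ?q a \<in> S} \<inter> {a \<in> topspace T. ?q a \<in> S'}" by auto
    with S S' show "openin T {a \<in> topspace T. ?q a \<in> S \<inter> S'}" by auto
    show "S \<inter> S' \<subseteq> ?q ` topspace T" using S by auto
  next
    fix \<K> assume K: "\<forall>S\<in>\<K>. ?P S"
    have "{a \<in> topspace T. ?q a \<in> \<Union>\<K>} = (\<Union>S\<in>\<K>. {a \<in> topspace T. ?q a \<in> S})" by auto
    with K show "openin T {a \<in> topspace T. ?q a \<in> \<Union>\<K>}" by auto
    show "\<Union>\<K> \<subseteq> ?q ` topspace T" using K by auto
  qed
  then show ?thesis
    by (simp add: coset_space_def)
qed

lemma topspace_coset_space: "topspace (coset_space T add H) = left_coset add H ` topspace T"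
proof
  have "{a \<in> topspace T. left_coset add H a \<in> left_coset add H ` topspace T} = topspace T"
    by auto
  then have "openin (coset_space T add H) (left_coset add H ` topspace T)"
    by (simp add: openin_coset_space)
  then show "left_coset add H ` topspace T \<subseteq> topspace (coset_space T add H)"
    by (rule openin_subset)
next
  show "topspace (coset_space T add H) \<subseteq> left_coset add H ` topspace T"
    using openin_topspace openin_coset_space by blast
qed

lemma quotient_map_coset_space: "quotient_map T (coset_space T add H) (left_coset add H)"
  by (simp add: quotient_map_def topspace_coset_space openin_coset_space)

section \<open>Classes of spaces and Dugundji compacta\<close>

text \<open>
  A class of Hausdorff Lindelof spaces closed under finite products. The members are topologies on
  subsets of one type \<open>'a\<close>, whereas the product of two of them lives on \<open>'a \<times> 'a\<close>; hence the
  product is required to belong to the class up to homeomorphism.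
\<close>

definition productive_Lindelof_class :: "'a topology set \<Rightarrow> bool" where
  "productive_Lindelof_class \<L> \<longleftrightarrow>
     (\<forall>X\<in>\<L>. Lindelof_space X \<and> Hausdorff_space X) \<and>
     (\<forall>X\<in>\<L>. \<forall>Y\<in>\<L>. \<exists>P\<in>\<L>. P homeomorphic_space prod_topology X Y)"

text \<open>
  HOL cannot quantify over types inside a definition, so the type carrying the test spaces \<open>Z\<close> is a
  parameter; a theorem whose conclusion is \<open>Dugundji_space TYPE('z) X\<close> with \<open>'z\<close> a type variable
  covers the test spaces on every type. For empty \<open>X\<close> the
  extension property fails (\<open>A = {}\<close> and \<open>Z\<close> nonempty), so the empty space is not Dugundji.
\<close>

definition Dugundji_space :: "'z itself \<Rightarrow> 'a topology \<Rightarrow> bool" where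
  "Dugundji_space (_ :: 'z itself) X \<longleftrightarrow>
     compact_space X \<and> Hausdorff_space X \<and>
     (\<forall>(Z :: 'z topology) A f.
        compact_space Z \<and> Hausdorff_space Z \<and> Z dim_le 0 \<and> closedin Z A \<and>
        continuous_map (subtopology Z A) X f \<longrightarrow>
        (\<exists>g. continuous_map Z X g \<and> (\<forall>z\<in>A. g z = f z)))"

end

theory Submission
  imports Defs
begin

text \<open>
  The coset space \<open>X = G/H\<close> is regular and Lindelof, hence normal, and \<open>G\<close> moves its points by the
  homeomorphisms \<open>x \<mapsto> g x\<close>. Call a set \<open>S\<close> of continuous real functions on \<open>X\<close> invariant if
  agreement of all its members at \<open>x\<close> and \<open>y\<close> implies their agreement at \<open>g x\<close> and \<open>g y\<close> for all \<open>g\<close>.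
  As \<open>G \<times> G\<close> is Lindelof, every countable set of functions lies in a countable invariant one. If \<open>S\<close>
  is invariant and \<open>K\<close> is saturated for the diagonal map \<open>p\<close> of \<open>S\<close>, then \<open>p\<close> restricted to \<open>K\<close> is
  open onto its image; this uses \<open>(b, a, x) \<mapsto> b (\<ominus> a x)\<close> as a substitute for a Mal'tsev operation.
  A compact \<open>G\<^sub>\<delta>\<close>-set is saturated for some countable family.

  A map into \<open>K\<close> defined on a closed subset of \<open>Z\<close> is extended one coordinate at a time: by Zorn's
  lemma there is a maximal invariant \<open>S\<close> for which its composition with \<open>p\<close> extends to a map from \<open>Z\<close>
  into \<open>p(K)\<close>. As \<open>p\<close> is open on \<open>K\<close>, Michael's zero-dimensional selection theorem extends the map over
  countably many further functions, so the maximal \<open>S\<close> contains all functions.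
\<close>

section \<open>Selections over zero-dimensional compacta\<close>

lemma continuous_map_euclideanreal_locally:
  assumes "\<And>z e. z \<in> topspace Z \<Longrightarrow> e > 0 \<Longrightarrow>
      \<exists>W. openin Z W \<and> z \<in> W \<and> (\<forall>w\<in>W. \<bar>f w - f z\<bar> < (e::real))"
  shows "continuous_map Z euclideanreal f"
  unfolding continuous_map_def
proof (intro conjI allI impI)
  fix U :: "real set" assume "openin euclideanreal U"
  then have "open U" by simp
  show "openin Z {x \<in> topspace Z. f x \<in> U}"
    unfolding openin_subopen [of Z "{x \<in> topspace Z. f x \<in> U}"]
  proof
    fix z assume z: "z \<in> {x \<in> topspace Z. f x \<in> U}"
    then obtain e where "e > 0" and e: "\<forall>y. dist y (f z) < e \<longrightarrow> y \<in> U"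
      using \<open>open U\<close> by (auto simp: open_dist)
    obtain W where W: "openin Z W" "z \<in> W" "\<forall>w\<in>W. \<bar>f w - f z\<bar> < e"
      using assms[of z e] z \<open>e > 0\<close> by auto
    then have "W \<subseteq> {x \<in> topspace Z. f x \<in> U}"
      using e openin_subset[OF W(1)] by (auto simp: dist_real_def)
    then show "\<exists>T. openin Z T \<and> z \<in> T \<and> T \<subseteq> {x \<in> topspace Z. f x \<in> U}"
      using W by blast
  qed
qed auto

lemma openin_real_near:
  assumes "continuous_map X euclideanreal f"
  shows "openin X {x \<in> topspace X. \<bar>c - f x\<bar> < e}"
proof -
  have "openin X {x \<in> topspace X. f x \<in> {c - e<..<c + e}}"
    using assms by (rule openin_continuous_map_preimage) auto
  moreover have "{x \<in> topspace X. f x \<in> {c - e<..<c + e}} = {x \<in> topspace X. \<bar>c - f x\<bar> < e}"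
    by auto
  ultimately show ?thesis by simp
qed

lemma closedin_real_near:
  assumes "continuous_map X euclideanreal f"
  shows "closedin X {x \<in> topspace X. \<bar>c - f x\<bar> \<le> e}"
proof -
  have "closedin X {x \<in> topspace X. f x \<in> {c - e..c + e}}"
    using assms by (rule closedin_continuous_map_preimage) auto
  moreover have "{x \<in> topspace X. f x \<in> {c - e..c + e}} = {x \<in> topspace X. \<bar>c - f x\<bar> \<le> e}"
    by auto
  ultimately show ?thesis by simp
qed

text \<open>Where members of the cover overlap, the set inserted last takes precedence. As that set
  is closed, the level sets of the earlier choice stay open when it is removed from them.\<close>

lemma finite_clopen_choice:
  assumes "finite \<W>"
    and "\<And>W. W \<in> \<W> \<Longrightarrow> openin Z W \<and> closedin Z W \<and> (\<exists>k. \<forall>w\<in>W. R k w)"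
  shows "\<exists>\<phi>. (\<forall>k. openin Z {z \<in> \<Union>\<W>. \<phi> z = k}) \<and> (\<forall>z\<in>\<Union>\<W>. R (\<phi> z) z)"
  using assms
proof (induction \<W> rule: finite_induct)
  case (insert W \<W>)
  then obtain \<phi> where \<phi>: "\<And>k. openin Z {z \<in> \<Union>\<W>. \<phi> z = k}" "\<And>z. z \<in> \<Union>\<W> \<Longrightarrow> R (\<phi> z) z"
    by fastforce
  obtain c where W: "openin Z W" "closedin Z W" and c: "\<forall>w\<in>W. R c w"
    using insert.prems by blast
  define \<psi> where "\<psi> z = (if z \<in> W then c else \<phi> z)" for z
  have "openin Z {z \<in> \<Union>(insert W \<W>). \<psi> z = k}" for k
  proof -
    have "{z \<in> \<Union>(insert W \<W>). \<psi> z = k} = (if k = c then W else {}) \<union> ({z \<in> \<Union>\<W>. \<phi> z = k} - W)"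
      by (auto simp: \<psi>_def)
    then show ?thesis
      using W \<phi>(1) by (auto intro!: openin_Un openin_diff)
  qed
  moreover have "\<forall>z\<in>\<Union>(insert W \<W>). R (\<psi> z) z"
    using \<phi>(2) c by (auto simp: \<psi>_def)
  ultimately show ?case by blast
qed auto

text \<open>Clopen sets form a base of \<open>Z\<close> and compactness leaves finitely many of
  them, so a requirement that a constant meets near each point is met globally by a locally constant
  map.\<close>

lemma locally_constant_choice:
  assumes "compact_space Z" "Z dim_le 0"
    and "\<And>z. z \<in> topspace Z \<Longrightarrow> \<exists>k W. openin Z W \<and> z \<in> W \<and> (\<forall>w\<in>W. R k w)"
  shows "\<exists>\<phi>. (\<forall>k. openin Z {z \<in> topspace Z. \<phi> z = k}) \<and> (\<forall>z\<in>topspace Z. R (\<phi> z) z)"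
proof -
  let ?\<U> = "{W. openin Z W \<and> closedin Z W \<and> (\<exists>k. \<forall>w\<in>W. R k w)}"
  have "topspace Z \<subseteq> \<Union>?\<U>"
  proof
    fix z assume "z \<in> topspace Z"
    then obtain k W where W: "openin Z W" "z \<in> W" "\<forall>w\<in>W. R k w"
      using assms(3) by blast
    then obtain V where "openin Z V \<and> closedin Z V" "z \<in> V" "V \<subseteq> W"
      using assms(2) unfolding dimension_le_0_neighbourhood_base_of_clopen neighbourhood_base_of
      by (metis subset_eq)
    then show "z \<in> \<Union>?\<U>" using W by blast
  qed
  then obtain \<W> where \<W>: "finite \<W>" "\<W> \<subseteq> ?\<U>" "topspace Z \<subseteq> \<Union>\<W>"
    using assms(1) unfolding compact_space_alt by (smt (verit) mem_Collect_eq)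
  then have "\<Union>\<W> = topspace Z"
    using openin_subset by blast
  moreover have "\<exists>\<phi>. (\<forall>k. openin Z {z \<in> \<Union>\<W>. \<phi> z = k}) \<and> (\<forall>z\<in>\<Union>\<W>. R (\<phi> z) z)"
    using finite_clopen_choice[OF \<W>(1), of Z R] \<W>(2) by blast
  ultimately show ?thesis
    by simp
qed

text \<open>One index controls both the number of coordinates compared and the tolerance, so for
  fixed \<open>x\<close> the sets of \<open>y\<close> with \<open>near t n x y\<close> shrink to a
  neighbourhood base of \<open>x\<close> in the topology generated by \<open>t\<close>.\<close>

definition near :: "(nat \<Rightarrow> 'a \<Rightarrow> real) \<Rightarrow> nat \<Rightarrow> 'a \<Rightarrow> 'a \<Rightarrow> bool" where
  "near t n x y \<longleftrightarrow> (\<forall>i\<le>n. \<bar>t i x - t i y\<bar> < (1/2) ^ n)"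

lemma near_refl: "near t n x x"
  by (simp add: near_def)

lemma openin_near:
  assumes "\<And>i. continuous_map X euclideanreal (t i)"
  shows "openin X {y \<in> topspace X. near t n x y}"
proof -
  have "{y \<in> topspace X. near t n x y} =
      (\<Inter>i\<in>{..n}. {y \<in> topspace X. \<bar>t i x - t i y\<bar> < (1/2) ^ n})"
    by (auto simp: near_def)
  then show ?thesis
    using openin_real_near[OF assms] by (auto intro!: openin_Inter)
qed

text \<open>
  Michael's zero-dimensional selection theorem, for the pseudometrizable topology given by countably
  many functions: only the values of these functions on the selection are continuous.
\<close>

lemma zero_dimensional_selection:
  assumes Z: "compact_space Z" "Z dim_le 0" and X: "compact_space X"
    and t: "\<And>i. continuous_map X euclideanreal (t i)"
    and closed: "\<And>z. z \<in> topspace Z \<Longrightarrow> closedin X (\<Phi> z)"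
    and nonempty: "\<And>z. z \<in> topspace Z \<Longrightarrow> \<Phi> z \<noteq> {}"
    and lsc: "\<And>n x. x \<in> topspace X \<Longrightarrow> openin Z {z \<in> topspace Z. \<exists>y\<in>\<Phi> z. near t n x y}"
  obtains \<kappa> where "\<And>z. z \<in> topspace Z \<Longrightarrow> \<kappa> z \<in> \<Phi> z"
    "\<And>i. continuous_map Z euclideanreal (\<lambda>z. t i (\<kappa> z))"
proof -
  \<comment> \<open>Approximate selections: the values of a locally constant map need not lie in
    \<open>\<Phi> z\<close>, but some point of \<open>\<Phi> z\<close> is near them.
    \<open>Q n\<close> bounds the move to the next stage.\<close>
  define P where "P n \<phi> \<longleftrightarrow> (\<forall>k. openin Z {z \<in> topspace Z. \<phi> z = k}) \<and>
    (\<forall>z\<in>topspace Z. \<phi> z \<in> topspace X \<and> (\<exists>y\<in>\<Phi> z. near t n (\<phi> z) y))" for n \<phi>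
  define Q where "Q n \<phi> \<psi> \<longleftrightarrow> (\<forall>z\<in>topspace Z. near t n (\<phi> z) (\<psi> z))" for n :: nat and \<phi> \<psi>
  have \<Phi>_sub: "\<Phi> z \<subseteq> topspace X" if "z \<in> topspace Z" for z
    using closed[OF that] closedin_subset by blast
  have "\<exists>\<phi>. P 0 \<phi>"
  proof -
    have cover: "\<exists>k W. openin Z W \<and> z \<in> W \<and> (\<forall>w\<in>W. k \<in> topspace X \<and> (\<exists>y\<in>\<Phi> w. near t 0 k y))"
      if z: "z \<in> topspace Z" for z
    proof -
      obtain k where k: "k \<in> \<Phi> z" using nonempty[OF z] by blast
      then have "k \<in> topspace X" using \<Phi>_sub z by blast
      then show ?thesis
        using lsc[of k 0] k z near_refl[of t 0 k]
        by (intro exI[of _ k] exI[of _ "{z \<in> topspace Z. \<exists>y\<in>\<Phi> z. near t 0 k y}"]) auto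
    qed
    show ?thesis
      unfolding P_def by (rule locally_constant_choice[OF Z cover])
  qed
  moreover have "\<exists>\<psi>. P (Suc n) \<psi> \<and> Q n \<phi> \<psi>" if \<phi>: "P n \<phi>" for \<phi> n
  proof -
    let ?R = "\<lambda>k w. k \<in> topspace X \<and> (\<exists>y\<in>\<Phi> w. near t (Suc n) k y) \<and> near t n (\<phi> w) k"
    have cover: "\<exists>k W. openin Z W \<and> z \<in> W \<and> (\<forall>w\<in>W. ?R k w)" if z: "z \<in> topspace Z" for z
    proof -
      \<comment> \<open>The next value is a point of \<open>\<Phi> z\<close> near the old one. It
        remains usable where the old map is constant and, by lower semicontinuity,
        \<open>\<Phi> w\<close> still comes near it.\<close>
      obtain k where k: "k \<in> \<Phi> z" "near t n (\<phi> z) k"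
        using \<phi> z unfolding P_def by blast
      then have kX: "k \<in> topspace X" using \<Phi>_sub z by blast
      let ?W = "{w \<in> topspace Z. \<exists>y\<in>\<Phi> w. near t (Suc n) k y} \<inter> {w \<in> topspace Z. \<phi> w = \<phi> z}"
      have "openin Z ?W"
        using lsc[OF kX] \<phi> unfolding P_def by (blast intro: openin_Int)
      then show ?thesis
        using k kX z near_refl[of t "Suc n" k] by (intro exI[of _ k] exI[of _ ?W]) auto
    qed
    have "\<exists>\<psi>. (\<forall>k. openin Z {z \<in> topspace Z. \<psi> z = k}) \<and> (\<forall>z\<in>topspace Z. ?R (\<psi> z) z)"
      by (rule locally_constant_choice[OF Z cover])
    then show ?thesis unfolding P_def Q_def by blast
  qed
  ultimately have "\<exists>\<phi>. \<forall>n. P n (\<phi> n) \<and> Q n (\<phi> n) (\<phi> (Suc n))"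
    by (rule dependent_nat_choice)
  then obtain \<phi> where PQ: "\<forall>n. P n (\<phi> n) \<and> Q n (\<phi> n) (\<phi> (Suc n))"
    by (rule exE)
  from PQ have \<phi>: "\<And>n k. openin Z {z \<in> topspace Z. \<phi> n z = k}"
    "\<And>n z. z \<in> topspace Z \<Longrightarrow> \<exists>y\<in>\<Phi> z. near t n (\<phi> n z) y"
    "\<And>n z. z \<in> topspace Z \<Longrightarrow> near t n (\<phi> n z) (\<phi> (Suc n) z)"
    unfolding P_def Q_def by auto
  \<comment> \<open>Compactness replaces completeness: the limit is a common point of nested closed
    sets. The factor 2 makes them nested, as (1/2)^n + 2 * (1/2)^(n+1) = 2 * (1/2)^n.\<close>
  define C where "C z n = {k \<in> \<Phi> z. \<forall>i\<le>n. \<bar>t i (\<phi> n z) - t i k\<bar> \<le> 2 * (1/2) ^ n}" for z n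
  have "(\<Inter>n. C z n) \<noteq> {}" if z: "z \<in> topspace Z" for z
  proof (rule compact_space_imp_nest[OF X])
    show "closedin X (C z n)" for n
    proof -
      have "C z n = \<Phi> z \<inter> (\<Inter>i\<in>{..n}. {k \<in> topspace X. \<bar>t i (\<phi> n z) - t i k\<bar> \<le> 2 * (1/2) ^ n})"
        using \<Phi>_sub[OF z] by (auto simp: C_def)
      then show ?thesis
        using closedin_real_near[OF t] closed[OF z] by (auto intro!: closedin_Inter)
    qed
    show "C z n \<noteq> {}" for n
    proof -
      obtain y where y: "y \<in> \<Phi> z" "near t n (\<phi> n z) y" using \<phi>(2)[OF z] by blast
      have "\<bar>t i (\<phi> n z) - t i y\<bar> \<le> 2 * (1/2) ^ n" if "i \<le> n" for i
      proof -
        have "\<bar>t i (\<phi> n z) - t i y\<bar> < (1/2) ^ n"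
          using y(2) that by (auto simp: near_def)
        moreover have "(0::real) < (1/2) ^ n" by simp
        ultimately show ?thesis by linarith
      qed
      then show ?thesis using y unfolding C_def by blast
    qed
    show "decseq (C z)"
      unfolding decseq_Suc_iff
    proof (intro allI subsetI)
      fix n k assume k: "k \<in> C z (Suc n)"
      have "\<bar>t i (\<phi> n z) - t i k\<bar> \<le> 2 * (1/2) ^ n" if "i \<le> n" for i
      proof -
        have "\<bar>t i (\<phi> (Suc n) z) - t i k\<bar> \<le> (1/2) ^ n"
          using k that by (auto simp: C_def)
        moreover have "\<bar>t i (\<phi> n z) - t i (\<phi> (Suc n) z)\<bar> < (1/2) ^ n"
          using \<phi>(3)[OF z, of n] that by (auto simp: near_def)
        ultimately show ?thesis by linarith
      qed
      then show "k \<in> C z n" using k by (auto simp: C_def)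
    qed
  qed
  then have "\<forall>z\<in>topspace Z. \<exists>k. \<forall>n. k \<in> C z n" by fastforce
  then obtain \<kappa> where \<kappa>: "\<And>z n. z \<in> topspace Z \<Longrightarrow> \<kappa> z \<in> C z n"
    using bchoice[of "topspace Z" "\<lambda>z k. \<forall>n. k \<in> C z n"] by blast
  show thesis
  proof
    show "\<kappa> z \<in> \<Phi> z" if "z \<in> topspace Z" for z
      using \<kappa>[OF that, of 0] by (auto simp: C_def)
    show "continuous_map Z euclideanreal (\<lambda>z. t i (\<kappa> z))" for i
    proof (rule continuous_map_euclideanreal_locally)
      fix z and e :: real assume z: "z \<in> topspace Z" and "e > 0"
      then obtain m where m: "(1/2) ^ m < e / 4"
        using real_arch_pow_inv[of "e/4" "1/2"] by auto
      \<comment> \<open>\<open>n \<ge> i\<close> puts \<open>t i\<close> under the control of stage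
        \<open>n\<close>; \<open>n \<ge> m\<close> makes the two errors of 2 * (1/2)^n add up to
        less than \<open>e\<close>.\<close>
      define n where "n = max i m"
      have "((1::real)/2) ^ n \<le> (1/2) ^ m"
        by (rule power_decreasing) (auto simp: n_def)
      then have n: "(1/2) ^ n < e / 4" using m by linarith
      have "i \<le> n" by (simp add: n_def)
      let ?W = "{w \<in> topspace Z. \<phi> n w = \<phi> n z}"
      have "\<bar>t i (\<kappa> w) - t i (\<kappa> z)\<bar> < e" if "w \<in> ?W" for w
      proof -
        have "\<bar>t i (\<phi> n w) - t i (\<kappa> w)\<bar> \<le> 2 * (1/2) ^ n" "\<bar>t i (\<phi> n z) - t i (\<kappa> z)\<bar> \<le> 2 * (1/2) ^ n"
          using \<kappa>[of w n] \<kappa>[of z n] that z \<open>i \<le> n\<close> by (auto simp: C_def)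
        moreover have "t i (\<phi> n w) = t i (\<phi> n z)" using that by simp
        ultimately show ?thesis using n by linarith
      qed
      then show "\<exists>W. openin Z W \<and> z \<in> W \<and> (\<forall>w\<in>W. \<bar>t i (\<kappa> w) - t i (\<kappa> z)\<bar> < e)"
        using \<phi>(1) z by (intro exI[of _ ?W]) auto
    qed
  qed
qed

section \<open>A criterion for Dugundji compacta\<close>

lemma openin_prod_box:
  assumes "openin (prod_topology X Y) E" "(a, b) \<in> E"
  obtains U V where "openin X U" "openin Y V" "a \<in> U" "b \<in> V" "U \<times> V \<subseteq> E"
  using assms unfolding openin_prod_topology_alt by metis

lemma closedin_equalizer_real:
  assumes "continuous_map X euclideanreal f" "continuous_map X euclideanreal g"
  shows "closedin X {x \<in> topspace X. f x = g x}"
proof -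
  have "closedin X {x \<in> topspace X. f x - g x \<in> {0}}"
    by (rule closedin_continuous_map_preimage[of X euclideanreal])
      (auto intro!: continuous_map_diff assms)
  then show ?thesis by simp
qed

text \<open>Points of one fibre agree under all \<open>s\<close>, so a fibre meets \<open>U\<close>
  exactly when it lies in the hull of \<open>U\<close>. The fibres leaving the hull form the
  projection of a closed set along the compact factor \<open>X\<close>, hence a closed set.\<close>

lemma openin_fibre_meets:
  assumes X: "compact_space X"
    and cont: "\<And>s \<phi>. (s, \<phi>) \<in> P \<Longrightarrow>
      continuous_map X euclideanreal s \<and> continuous_map Z euclideanreal \<phi>"
    and realized: "\<And>z. z \<in> topspace Z \<Longrightarrow> \<exists>x\<in>topspace X. \<forall>(s, \<phi>)\<in>P. s x = \<phi> z"
    and hull: "openin X {y \<in> topspace X. \<exists>x\<in>U. \<forall>s\<in>fst ` P. s x = s y}"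
    and U: "openin X U"
  shows "openin Z {z \<in> topspace Z. \<exists>x\<in>U. \<forall>(s, \<phi>)\<in>P. s x = \<phi> z}"
proof -
  let ?V = "{y \<in> topspace X. \<exists>x\<in>U. \<forall>s\<in>fst ` P. s x = s y}"
  \<comment> \<open>The inserted whole space keeps the family nonempty when \<open>P\<close> is
    empty.\<close>
  define E where "E = {p \<in> topspace (prod_topology Z X). snd p \<in> topspace X - ?V} \<inter>
      \<Inter>(insert (topspace (prod_topology Z X))
        ((\<lambda>(s, \<phi>). {p \<in> topspace (prod_topology Z X). s (snd p) = \<phi> (fst p)}) ` P))"
  have "closedin (prod_topology Z X) E"
    unfolding E_def
  proof (intro closedin_Int closedin_Inter)
    show "closedin (prod_topology Z X) {p \<in> topspace (prod_topology Z X). snd p \<in> topspace X - ?V}"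
      by (rule closedin_continuous_map_preimage[OF continuous_map_snd]) (use hull in blast)
    fix C assume "C \<in> insert (topspace (prod_topology Z X))
        ((\<lambda>(s, \<phi>). {p \<in> topspace (prod_topology Z X). s (snd p) = \<phi> (fst p)}) ` P)"
    then consider "C = topspace (prod_topology Z X)"
      | s \<phi> where "(s, \<phi>) \<in> P" "C = {p \<in> topspace (prod_topology Z X). s (snd p) = \<phi> (fst p)}"
      by auto
    then show "closedin (prod_topology Z X) C"
    proof cases
      case 1
      then show ?thesis by (simp only: closedin_topspace)
    next
      case 2
      have "continuous_map (prod_topology Z X) euclideanreal (\<lambda>p. s (snd p))"
        "continuous_map (prod_topology Z X) euclideanreal (\<lambda>p. \<phi> (fst p))"
        using cont[OF 2(1)] continuous_map_compose[OF continuous_map_snd, of X euclideanreal s Z]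
          continuous_map_compose[OF continuous_map_fst, of Z euclideanreal \<phi> X]
        by (auto simp: o_def)
      then show ?thesis
        unfolding 2(2) by (rule closedin_equalizer_real)
    qed
  qed auto
  then have "closedin Z (fst ` E)"
    using closed_map_fst[OF X] unfolding closed_map_def by blast
  moreover have "topspace Z - fst ` E = {z \<in> topspace Z. \<exists>x\<in>U. \<forall>(s, \<phi>)\<in>P. s x = \<phi> z}"
  proof (intro equalityI subsetI)
    fix z assume z: "z \<in> topspace Z - fst ` E"
    then obtain y where y: "y \<in> topspace X" "\<forall>(s, \<phi>)\<in>P. s y = \<phi> z"
      using realized by blast
    have "(z, y) \<notin> E" using z by force
    then have "y \<in> ?V" using y z by (auto simp: E_def)
    then obtain x where "x \<in> U" "\<forall>s\<in>fst ` P. s x = s y" by blast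
    then have "\<forall>(s, \<phi>)\<in>P. s x = \<phi> z" using y by force
    then show "z \<in> {z \<in> topspace Z. \<exists>x\<in>U. \<forall>(s, \<phi>)\<in>P. s x = \<phi> z}"
      using z \<open>x \<in> U\<close> by blast
  next
    fix z assume "z \<in> {z \<in> topspace Z. \<exists>x\<in>U. \<forall>(s, \<phi>)\<in>P. s x = \<phi> z}"
    then obtain x where z: "z \<in> topspace Z" and x: "x \<in> U" "\<forall>(s, \<phi>)\<in>P. s x = \<phi> z" by blast
    have "(z, y) \<notin> E" for y
    proof
      assume "(z, y) \<in> E"
      then have "y \<in> topspace X" "y \<notin> ?V" "\<forall>(s, \<phi>)\<in>P. s y = \<phi> z"
        by (auto simp: E_def)
      then show False using x by force
    qed
    then show "z \<in> topspace Z - fst ` E" using z by auto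
  qed
  ultimately show ?thesis
    by (metis (lifting) openin_diff openin_topspace)
qed

text \<open>The selection theorem is applied to the fibres of \<open>P\<close>, which are lower
  semicontinuous by \<open>openin_fibre_meets\<close>. The map \<open>\<kappa>\<close> itself need
  not be continuous, only its compositions with the \<open>t i\<close>.\<close>

lemma extend_partial_lift:
  assumes Z: "compact_space Z" "Z dim_le 0" and X: "compact_space X"
    and A: "closedin Z A" and f: "continuous_map (subtopology Z A) X f"
    and P: "\<And>s \<phi>. (s, \<phi>) \<in> P \<Longrightarrow> continuous_map X euclideanreal s \<and>
      continuous_map Z euclideanreal \<phi> \<and> (\<forall>z\<in>A. \<phi> z = s (f z))"
    and realized: "\<And>z. z \<in> topspace Z \<Longrightarrow> \<exists>x\<in>topspace X. \<forall>(s, \<phi>)\<in>P. s x = \<phi> z"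
    and hull: "\<And>U. openin X U \<Longrightarrow> openin X {y \<in> topspace X. \<exists>x\<in>U. \<forall>s\<in>fst ` P. s x = s y}"
    and t: "\<And>i :: nat. continuous_map X euclideanreal (t i)"
  shows "\<exists>\<kappa>. (\<forall>z\<in>topspace Z. \<kappa> z \<in> topspace X \<and> (\<forall>(s, \<phi>)\<in>P. s (\<kappa> z) = \<phi> z)) \<and>
    (\<forall>i. continuous_map Z euclideanreal (\<lambda>z. t i (\<kappa> z))) \<and> (\<forall>z\<in>A. \<forall>i. t i (\<kappa> z) = t i (f z))"
proof -
  have A_sub: "A \<subseteq> topspace Z" using A closedin_subset by blast
  then have fA: "f z \<in> topspace X" if "z \<in> A" for z
    using f that unfolding continuous_map_def by auto
  \<comment> \<open>Over \<open>A\<close> the values \<open>t i x\<close> are prescribed instead of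
    the point \<open>x\<close> itself; this keeps the set closed although \<open>X\<close> is not
    assumed Hausdorff here.\<close>
  define \<Phi> where "\<Phi> z = {x \<in> topspace X. (\<forall>(s, \<phi>)\<in>P. s x = \<phi> z) \<and>
      (z \<in> A \<longrightarrow> (\<forall>i. t i x = t i (f z)))}" for z
  have f\<Phi>: "f z \<in> \<Phi> z" if "z \<in> A" for z
    using fA[OF that] P that by (fastforce simp: \<Phi>_def)
  have "closedin X (\<Phi> z)" if z: "z \<in> topspace Z" for z
  proof -
    have eq: "\<Phi> z = topspace X \<inter> \<Inter>(insert (topspace X)
          ((\<lambda>(s, \<phi>). {x \<in> topspace X. s x = \<phi> z}) ` P)) \<inter>
        (if z \<in> A then \<Inter>i. {x \<in> topspace X. t i x = t i (f z)} else topspace X)"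
      by (auto simp: \<Phi>_def)
    show ?thesis
      unfolding eq
      by (intro closedin_Int closedin_Inter)
        (auto dest!: P intro!: closedin_Inter closedin_equalizer_real t)
  qed
  moreover have "\<Phi> z \<noteq> {}" if z: "z \<in> topspace Z" for z
  proof (cases "z \<in> A")
    case True then show ?thesis using f\<Phi> by blast
  next
    case False then show ?thesis using realized[OF z] by (auto simp: \<Phi>_def)
  qed
  moreover have "openin Z {z \<in> topspace Z. \<exists>y\<in>\<Phi> z. near t n x y}" for n x
  proof -
    let ?U = "{y \<in> topspace X. near t n x y}"
    let ?N = "{z \<in> topspace Z. \<exists>y\<in>?U. \<forall>(s, \<phi>)\<in>P. s y = \<phi> z}"
    have U: "openin X ?U" using t by (rule openin_near)
    have N: "openin Z ?N"
      by (rule openin_fibre_meets[OF X _ realized hull[OF U] U]) (use P in auto)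
    have "openin (subtopology Z A) {z \<in> topspace (subtopology Z A). f z \<in> ?U}"
      using f U by (rule openin_continuous_map_preimage)
    then obtain O' where O': "openin Z O'" "{z \<in> topspace (subtopology Z A). f z \<in> ?U} = O' \<inter> A"
      unfolding openin_subtopology by blast
    then have O'_iff: "z \<in> O' \<longleftrightarrow> f z \<in> ?U" if "z \<in> A" for z
      using that A_sub by auto
    \<comment> \<open>Over \<open>A\<close> a near point exists exactly when \<open>f z\<close> is
      near, which \<open>O'\<close> expresses by an open set of \<open>Z\<close>. Off the closed set
      \<open>A\<close> only the fibre condition \<open>?N\<close> remains.\<close>
    have "{z \<in> topspace Z. \<exists>y\<in>\<Phi> z. near t n x y} = ?N \<inter> (O' \<union> (topspace Z - A))"
    proof (intro equalityI subsetI)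
      fix z assume "z \<in> {z \<in> topspace Z. \<exists>y\<in>\<Phi> z. near t n x y}"
      then obtain y where z: "z \<in> topspace Z" and y: "y \<in> \<Phi> z" "near t n x y" by blast
      have "f z \<in> ?U" if "z \<in> A"
        using y that fA by (auto simp: \<Phi>_def near_def)
      then show "z \<in> ?N \<inter> (O' \<union> (topspace Z - A))"
        using z y O'_iff by (auto simp: \<Phi>_def)
    next
      fix z assume z: "z \<in> ?N \<inter> (O' \<union> (topspace Z - A))"
      show "z \<in> {z \<in> topspace Z. \<exists>y\<in>\<Phi> z. near t n x y}"
      proof (cases "z \<in> A")
        case True
        then have "near t n x (f z)" using z O'_iff by auto
        then show ?thesis using z f\<Phi>[OF True] by blast
      next
        case False
        then show ?thesis using z by (auto simp: \<Phi>_def)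
      qed
    qed
    then show ?thesis
      using N O' A by (auto intro!: openin_Int openin_Un openin_diff)
  qed
  ultimately obtain \<kappa> where \<kappa>: "\<And>z. z \<in> topspace Z \<Longrightarrow> \<kappa> z \<in> \<Phi> z"
    and cont: "\<And>i. continuous_map Z euclideanreal (\<lambda>z. t i (\<kappa> z))"
    using zero_dimensional_selection[OF Z X, of t \<Phi>] t by blast
  show ?thesis
  proof (intro exI[of _ \<kappa>] conjI ballI allI cont)
    fix z assume "z \<in> topspace Z"
    then show "\<kappa> z \<in> topspace X" "\<And>p. p \<in> P \<Longrightarrow> case p of (s, \<phi>) \<Rightarrow> s (\<kappa> z) = \<phi> z"
      using \<kappa>[of z] by (auto simp: \<Phi>_def)
  next
    show "t i (\<kappa> z) = t i (f z)" if "z \<in> A" for i z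
      using \<kappa>[of z] that A_sub by (auto simp: \<Phi>_def)
  qed
qed

text \<open>This separates the extension argument from the algebra: \<open>good\<close> stands for
  the invariant families, of which open hulls, stability under unions and countable extendability
  are used.\<close>

lemma Dugundji_criterion:
  fixes X :: "'a topology" and C :: "('a \<Rightarrow> real) set" and good :: "('a \<Rightarrow> real) set \<Rightarrow> bool"
  assumes X: "compact_space X" "Hausdorff_space X" "topspace X \<noteq> {}"
    and C: "\<And>s. s \<in> C \<Longrightarrow> continuous_map X euclideanreal s"
    and separates: "\<And>U x. openin X U \<Longrightarrow> x \<in> U \<Longrightarrow>
      \<exists>s\<in>C. s x = 0 \<and> (\<forall>y\<in>topspace X - U. s y = 1)"
    and good_hull: "\<And>S U. good S \<Longrightarrow> S \<subseteq> C \<Longrightarrow> openin X U \<Longrightarrow>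
      openin X {y \<in> topspace X. \<exists>x\<in>U. \<forall>s\<in>S. s x = s y}"
    and good_Union: "\<And>\<S>. (\<And>S. S \<in> \<S> \<Longrightarrow> good S) \<Longrightarrow> good (\<Union>\<S>)"
    and good_extend: "\<And>S s. good S \<Longrightarrow> S \<subseteq> C \<Longrightarrow> s \<in> C \<Longrightarrow>
      \<exists>T\<subseteq>C. countable T \<and> s \<in> T \<and> good (S \<union> T)"
  shows "Dugundji_space TYPE('z) X"
  unfolding Dugundji_space_def
proof (intro conjI allI impI X)
  fix Z :: "'z topology" and A f
  assume "compact_space Z \<and> Hausdorff_space Z \<and> Z dim_le 0 \<and> closedin Z A \<and>
    continuous_map (subtopology Z A) X f"
  then have Z: "compact_space Z" "Z dim_le 0" and A: "closedin Z A"
    and f: "continuous_map (subtopology Z A) X f" by auto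
  have A_sub: "A \<subseteq> topspace Z" using A closedin_subset by blast
  \<comment> \<open>A pair \<open>(s, \<phi>)\<close> prescribes \<open>\<phi>\<close> as the
    composition of \<open>s\<close> with the extension sought. The last condition asks that at each
    \<open>z\<close> a single point of \<open>X\<close> meets all prescriptions; no continuity of
    its choice is demanded.\<close>
  define \<P> where "\<P> = {P :: (('a \<Rightarrow> real) \<times> ('z \<Rightarrow> real)) set. fst ` P \<subseteq> C \<and> good (fst ` P) \<and>
    (\<forall>(s, \<phi>)\<in>P. continuous_map Z euclideanreal \<phi> \<and> (\<forall>z\<in>A. \<phi> z = s (f z))) \<and>
    (\<forall>z\<in>topspace Z. \<exists>x\<in>topspace X. \<forall>(s, \<phi>)\<in>P. s x = \<phi> z)}"
  have \<P>_I: "P \<in> \<P>" if "good (fst ` P)" "fst ` P \<subseteq> C"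
    "\<forall>(s, \<phi>)\<in>P. continuous_map Z euclideanreal \<phi> \<and> (\<forall>z\<in>A. \<phi> z = s (f z))"
    "\<And>z. z \<in> topspace Z \<Longrightarrow> \<exists>x\<in>topspace X. \<forall>(s, \<phi>)\<in>P. s x = \<phi> z" for P
    using that by (simp add: \<P>_def)
  have \<P>_realized: "\<exists>x\<in>topspace X. \<forall>(s, \<phi>)\<in>P. s x = \<phi> z" if "P \<in> \<P>" "z \<in> topspace Z" for P z
    using that by (simp add: \<P>_def)
  have "\<exists>M\<in>\<P>. \<forall>P\<in>\<P>. M \<subseteq> P \<longrightarrow> P = M"
  proof (rule subset_Zorn_nonempty)
    \<comment> \<open>The empty relation starts the argument: the union of no families is good, and
      any point of the nonempty \<open>X\<close> realizes it.\<close>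
    obtain x where "x \<in> topspace X" using X(3) by blast
    moreover have "good {}" using good_Union[of "{}"] by simp
    ultimately have "{} \<in> \<P>" by (auto simp: \<P>_def intro: bexI[of _ x])
    then show "\<P> \<noteq> {}" by blast
  next
    fix \<C> assume ne: "\<C> \<noteq> {}" and chain: "subset.chain \<P> \<C>"
    then have sub: "\<C> \<subseteq> \<P>" and lin: "\<And>P Q. P \<in> \<C> \<Longrightarrow> Q \<in> \<C> \<Longrightarrow> P \<subseteq> Q \<or> Q \<subseteq> P"
      unfolding subset_chain_def by auto
    have "fst ` \<Union>\<C> = \<Union>((`) fst ` \<C>)" by blast
    moreover have "good (\<Union>((`) fst ` \<C>))"
      by (rule good_Union) (use sub in \<open>auto simp: \<P>_def\<close>)
    ultimately have "good (fst ` \<Union>\<C>)" by simp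
    moreover have "fst ` \<Union>\<C> \<subseteq> C" using sub unfolding \<P>_def by blast
    moreover have "\<forall>(s, \<phi>)\<in>\<Union>\<C>. continuous_map Z euclideanreal \<phi> \<and> (\<forall>z\<in>A. \<phi> z = s (f z))"
      using sub unfolding \<P>_def by blast
    moreover have "\<exists>x\<in>topspace X. \<forall>(s, \<phi>)\<in>\<Union>\<C>. s x = \<phi> z" if z: "z \<in> topspace Z" for z
    proof -
      \<comment> \<open>By compactness it suffices that finitely many of the closed sets
        \<open>F P\<close> meet; in a chain, the largest of finitely many relations gives the
        smallest of these sets.\<close>
      define F where "F P = {x \<in> topspace X. \<forall>(s, \<phi>)\<in>P. s x = \<phi> z}"
        for P :: "(('a \<Rightarrow> real) \<times> ('z \<Rightarrow> real)) set"
      have F: "closedin X (F P)" if "P \<in> \<C>" for P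
      proof -
        have eq: "F P = topspace X \<inter> \<Inter>(insert (topspace X)
            ((\<lambda>(s, \<phi>). {x \<in> topspace X. s x = \<phi> z}) ` P))"
          by (auto simp: F_def)
        have "P \<in> \<P>" using that sub by blast
        then have "fst ` P \<subseteq> C" by (simp add: \<P>_def)
        then have "continuous_map X euclideanreal s" if "(s, \<phi>) \<in> P" for s \<phi>
          using C that by force
        then show ?thesis
          unfolding eq by (intro closedin_Int closedin_Inter) (auto intro!: closedin_equalizer_real)
      qed
      have "\<Inter>\<F> \<noteq> {}" if "finite \<F>" "\<F> \<subseteq> F ` \<C>" for \<F>
      proof (cases "\<F> = {}")
        case False
        obtain \<D> where \<D>: "finite \<D>" "\<D> \<subseteq> \<C>" "\<F> = F ` \<D>"
          using \<open>finite \<F>\<close> \<open>\<F> \<subseteq> F ` \<C>\<close> by (meson finite_subset_image)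
        have "\<D> \<noteq> {}" using False \<D>(3) by blast
        moreover have "subset.chain \<C> \<D>" using \<D>(2) lin unfolding subset_chain_def by blast
        ultimately have P: "\<Union>\<D> \<in> \<D>" using \<D>(1) Union_in_chain by blast
        have "F (\<Union>\<D>) \<subseteq> F Q" if "Q \<in> \<D>" for Q using that by (auto simp: F_def)
        then have "F (\<Union>\<D>) \<subseteq> \<Inter>\<F>" unfolding \<D>(3) by blast
        moreover have "\<Union>\<D> \<in> \<P>" using P \<D>(2) sub by blast
        then have "F (\<Union>\<D>) \<noteq> {}" using \<P>_realized[OF _ z, of "\<Union>\<D>"] unfolding F_def by blast
        ultimately show ?thesis by blast
      qed auto
      then have "\<Inter>(F ` \<C>) \<noteq> {}"
        using F by (intro X(1)[unfolded compact_space_fip, rule_format]) auto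
      then obtain x where x: "\<And>P. P \<in> \<C> \<Longrightarrow> x \<in> F P" by blast
      then have "x \<in> topspace X" using ne unfolding F_def by blast
      moreover have "\<forall>(s, \<phi>)\<in>\<Union>\<C>. s x = \<phi> z" using x unfolding F_def by blast
      ultimately show ?thesis by (rule bexI[rotated])
    qed
    ultimately show "\<Union>\<C> \<in> \<P>" by (rule \<P>_I)
  qed
  then obtain P where P: "P \<in> \<P>" and max: "\<And>Q. Q \<in> \<P> \<Longrightarrow> P \<subseteq> Q \<Longrightarrow> Q = P" by blast
  have P_C: "fst ` P \<subseteq> C" "good (fst ` P)"
    and P_cont: "\<And>s \<phi>. (s, \<phi>) \<in> P \<Longrightarrow> continuous_map Z euclideanreal \<phi> \<and> (\<forall>z\<in>A. \<phi> z = s (f z))"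
    and realized: "\<And>z. z \<in> topspace Z \<Longrightarrow> \<exists>x\<in>topspace X. \<forall>(s, \<phi>)\<in>P. s x = \<phi> z"
    using P by (auto simp: \<P>_def)
  have s_cont: "continuous_map X euclideanreal s" if "(s, \<phi>) \<in> P" for s \<phi>
    using C P_C(1) that by force
  have total: "\<exists>\<phi>. (s, \<phi>) \<in> P" if s: "s \<in> C" for s
  proof -
    obtain T where T: "T \<subseteq> C" "countable T" "s \<in> T" "good (fst ` P \<union> T)"
      using good_extend[OF P_C(2,1) s] by blast
    \<comment> \<open>\<open>T\<close> contains \<open>s\<close> and so is nonempty; its
      enumeration, possibly with repetitions, has range \<open>T\<close>.\<close>
    define t where "t = from_nat_into T"
    have t: "range t = T" using T by (auto simp: t_def intro!: range_from_nat_into)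
    have t_cont: "continuous_map X euclideanreal (t i)" for i
      using C T(1) t by blast
    have "\<exists>\<kappa>. (\<forall>z\<in>topspace Z. \<kappa> z \<in> topspace X \<and> (\<forall>(s, \<phi>)\<in>P. s (\<kappa> z) = \<phi> z)) \<and>
        (\<forall>i. continuous_map Z euclideanreal (\<lambda>z. t i (\<kappa> z))) \<and> (\<forall>z\<in>A. \<forall>i. t i (\<kappa> z) = t i (f z))"
    proof (rule extend_partial_lift[OF Z X(1) A f])
      show "continuous_map X euclideanreal s \<and> continuous_map Z euclideanreal \<phi> \<and> (\<forall>z\<in>A. \<phi> z = s (f z))"
        if "(s, \<phi>) \<in> P" for s \<phi>
        using P_cont[OF that] s_cont[OF that] by simp
    qed (rule realized t_cont good_hull[OF P_C(2,1)]; assumption)+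
    then obtain \<kappa> where \<kappa>: "\<forall>z\<in>topspace Z. \<kappa> z \<in> topspace X \<and> (\<forall>(s, \<phi>)\<in>P. s (\<kappa> z) = \<phi> z)"
      "\<forall>i. continuous_map Z euclideanreal (\<lambda>z. t i (\<kappa> z))" "\<forall>z\<in>A. \<forall>i. t i (\<kappa> z) = t i (f z)"
      by (elim exE conjE)
    \<comment> \<open>\<open>\<kappa> z\<close> realizes the old and the new prescriptions together,
      so \<open>Q\<close> lies in \<open>\<P>\<close> and maximality puts the pair for
      \<open>s\<close> into \<open>P\<close>.\<close>
    define Q where "Q = P \<union> (\<lambda>i. (t i, \<lambda>z. t i (\<kappa> z))) ` UNIV"
    have "fst ` Q = fst ` P \<union> T"
      unfolding Q_def image_Un image_image fst_conv using t by simp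
    then have "good (fst ` Q)" "fst ` Q \<subseteq> C" using T P_C by simp_all
    moreover have "\<forall>(s, \<phi>)\<in>Q. continuous_map Z euclideanreal \<phi> \<and> (\<forall>z\<in>A. \<phi> z = s (f z))"
      using P_cont \<kappa>(2,3) by (auto simp: Q_def)
    moreover have "\<exists>x\<in>topspace X. \<forall>(s, \<phi>)\<in>Q. s x = \<phi> z" if "z \<in> topspace Z" for z
      using \<kappa>(1)[rule_format, OF that] by (intro bexI[of _ "\<kappa> z"]) (auto simp: Q_def)
    ultimately have "Q \<in> \<P>" by (rule \<P>_I)
    then have "Q = P" using max by (auto simp: Q_def)
    moreover obtain i where "t i = s" using t T(3) by blast
    ultimately show ?thesis unfolding Q_def by blast
  qed
  \<comment> \<open>Realizing points are chosen with no regard to continuity. It follows because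
    each \<open>s\<close> in \<open>C\<close> composed with \<open>g\<close> agrees on
    \<open>Z\<close> with a continuous \<open>\<phi>\<close>, and \<open>C\<close> separates points
    from closed sets.\<close>
  obtain g where g: "\<And>z. z \<in> topspace Z \<Longrightarrow> g z \<in> topspace X \<and> (\<forall>(s, \<phi>)\<in>P. s (g z) = \<phi> z)"
    using bchoice[of "topspace Z" "\<lambda>z x. x \<in> topspace X \<and> (\<forall>(s, \<phi>)\<in>P. s x = \<phi> z)"] realized by blast
  have "continuous_map Z X g"
    unfolding continuous_map_def
  proof (intro conjI allI impI)
    show "g \<in> topspace Z \<rightarrow> topspace X" using g by blast
    fix U assume U: "openin X U"
    show "openin Z {z \<in> topspace Z. g z \<in> U}"
      unfolding openin_subopen[of Z "{z \<in> topspace Z. g z \<in> U}"]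
    proof
      fix z assume z: "z \<in> {z \<in> topspace Z. g z \<in> U}"
      then obtain s where s: "s \<in> C" "s (g z) = 0" "\<forall>y\<in>topspace X - U. s y = 1"
        using separates[OF U, of "g z"] by blast
      obtain \<phi> where \<phi>: "(s, \<phi>) \<in> P" using total[OF s(1)] by blast
      have s\<phi>: "s (g w) = \<phi> w" if "w \<in> topspace Z" for w
        using g[OF that] \<phi> by blast
      let ?W = "{w \<in> topspace Z. \<bar>0 - \<phi> w\<bar> < 1}"
      have "openin Z ?W" by (rule openin_real_near) (use P_cont \<phi> in blast)
      moreover have "z \<in> ?W" using z s(2) s\<phi> by auto
      moreover have "?W \<subseteq> {z \<in> topspace Z. g z \<in> U}"
      proof
        fix w assume w: "w \<in> ?W"
        then have "s (g w) \<noteq> 1" "g w \<in> topspace X" using s\<phi> g by auto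
        then show "w \<in> {z \<in> topspace Z. g z \<in> U}" using w s(3) by blast
      qed
      ultimately show "\<exists>W. openin Z W \<and> z \<in> W \<and> W \<subseteq> {z \<in> topspace Z. g z \<in> U}" by blast
    qed
  qed
  moreover have "g z = f z" if z: "z \<in> A" for z
  proof (rule ccontr)
    assume neq: "g z \<noteq> f z"
    have zZ: "z \<in> topspace Z" using z A_sub by blast
    have fz: "f z \<in> topspace X" using f z zZ unfolding continuous_map_def by auto
    then obtain U V where U: "openin X U" "g z \<in> U" "f z \<notin> U"
      using X(2) neq g[OF zZ] unfolding Hausdorff_space_def by (metis disjnt_iff)
    obtain s where s: "s \<in> C" "s (g z) = 0" "s (f z) = 1"
      using separates[OF U(1,2)] U(3) fz by blast
    obtain \<phi> where \<phi>: "(s, \<phi>) \<in> P" using total[OF s(1)] by blast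
    then have "s (g z) = s (f z)" using g[OF zZ] P_cont[OF \<phi>] z by force
    then show False using s by simp
  qed
  ultimately show "\<exists>g. continuous_map Z X g \<and> (\<forall>z\<in>A. g z = f z)" by blast
qed

section \<open>Left coset spaces of gyrogroups\<close>

context gyrogroup
begin

lemma gyr_closed: "\<lbrakk>x \<in> G; y \<in> G; z \<in> G\<rbrakk> \<Longrightarrow> gyr x y z \<in> G"
  using bij_betwE[OF gyr_bij] by blast

text \<open>First \<open>gyr \<zero> a\<close> is the identity, because it disappears behind
  \<open>a\<close> and \<open>a\<close> can be cancelled by injectivity of
  \<open>gyr (\<ominus> a) a\<close>. The loop property identifies
  \<open>gyr (\<ominus> a) a\<close> with \<open>gyr \<zero> a\<close>. Left cancellation rests on
  this.\<close>

lemma gyr_neg_self: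
  assumes a: "a \<in> G" and z: "z \<in> G"
  shows "gyr (\<ominus> a) a z = z"
proof -
  have "\<ominus> a \<oplus> (a \<oplus> w) = gyr (\<ominus> a) a w" if "w \<in> G" for w
    using that a neg_closed gyr_assoc neg_inverse zero_identity gyr_closed by metis
  moreover have "a \<oplus> z = a \<oplus> gyr \<zero> a z"
    using a z zero_closed gyr_assoc[of \<zero> a z] zero_identity add_closed by metis
  ultimately have "gyr (\<ominus> a) a z = gyr (\<ominus> a) a (gyr \<zero> a z)"
    using a z zero_closed gyr_closed by metis
  then have "gyr \<zero> a z = z"
    using gyr_bij[of "\<ominus> a" a] a z neg_closed zero_closed gyr_closed
    unfolding bij_betw_def inj_on_def by metis
  then show ?thesis
    using gyr_loop[of "\<ominus> a" a z] a z neg_closed neg_inverse by simp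
qed

lemma neg_add_cancel: "\<lbrakk>a \<in> G; x \<in> G\<rbrakk> \<Longrightarrow> \<ominus> a \<oplus> (a \<oplus> x) = x"
  by (simp add: gyr_assoc neg_closed neg_inverse zero_identity gyr_neg_self)

lemma neg_neg: "a \<in> G \<Longrightarrow> \<ominus> (\<ominus> a) = a"
  using neg_unique[of "\<ominus> a" a] by (simp add: neg_closed neg_inverse)

lemma add_neg_cancel: "\<lbrakk>a \<in> G; x \<in> G\<rbrakk> \<Longrightarrow> a \<oplus> (\<ominus> a \<oplus> x) = x"
  using neg_add_cancel[of "\<ominus> a" x] by (simp add: neg_neg neg_closed)

end

section \<open>Subgyrogroups and the algebra of left cosets\<close>

context subgyrogroup
begin

lemma sub_add_closed: "\<lbrakk>x \<in> H; y \<in> H\<rbrakk> \<Longrightarrow> x \<oplus> y \<in> H"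
  using sub_gyrogroup gyrogroup.add_closed by metis

text \<open>The structure on \<open>H\<close> has its own identity and inverses. Its identity is
  idempotent, hence \<open>\<zero>\<close> by left cancellation; then its inverses agree with those
  of \<open>G\<close> by uniqueness.\<close>

lemma sub_zero_closed: "\<zero> \<in> H"
  and sub_neg_closed: "x \<in> H \<Longrightarrow> \<ominus> x \<in> H"
proof -
  obtain zero' neg' gyr' where "gyrogroup H add zero' neg' gyr'"
    using sub_gyrogroup by blast
  then interpret S: gyrogroup H add zero' neg' gyr' .
  have z: "zero' \<in> G" using S.zero_closed sub_subset by blast
  have "zero' \<oplus> zero' = zero'" using S.zero_identity S.zero_closed by blast
  then have eq: "zero' = \<zero>"
    using neg_add_cancel[OF z z] neg_inverse[OF z] by simp
  then show "\<zero> \<in> H" using S.zero_closed by simp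
  show "\<ominus> x \<in> H" if x: "x \<in> H" for x
  proof -
    have "neg' x = \<ominus> x"
      using S.neg_closed[OF x] S.neg_inverse[OF x] x sub_subset eq by (intro neg_unique) auto
    then show ?thesis using S.neg_closed[OF x] by simp
  qed
qed

end

context strong_subgyrogroup
begin

abbreviation coset :: "'a \<Rightarrow> 'a set" where
  "coset \<equiv> left_coset add H"

text \<open>Gyroassociativity produces \<open>gyr g a\<close>, which the strong subgyrogroup
  \<open>H\<close> absorbs. This need not be a group action: translating by \<open>h\<close> and
  then by \<open>g\<close> may differ from translating by \<open>g \<oplus> h\<close>.\<close>

lemma translate_coset:
  assumes "g \<in> G" "a \<in> G"
  shows "add g ` coset a = coset (g \<oplus> a)"
proof -
  have "add g ` coset a = add (g \<oplus> a) ` (gyr g a ` H)"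
    using assms sub_subset gyr_assoc by (force simp: left_coset_def image_image intro!: image_cong)
  then show ?thesis using assms gyr_image_sub by (simp add: left_coset_def)
qed

text \<open>Translating the identity \<open>coset h = H\<close> by \<open>a\<close> avoids handling
  the gyrations of \<open>(a \<oplus> h) \<oplus> k\<close>.\<close>

lemma coset_absorb:
  assumes "a \<in> G" "h \<in> H"
  shows "coset (a \<oplus> h) = coset a"
proof -
  have h: "h \<in> G" using assms sub_subset by blast
  have "coset h = H"
  proof
    show "coset h \<subseteq> H" using sub_add_closed assms by (auto simp: left_coset_def)
    have "k = h \<oplus> (\<ominus> h \<oplus> k)" "\<ominus> h \<oplus> k \<in> H" if "k \<in> H" for k
      using that assms sub_subset add_neg_cancel sub_add_closed sub_neg_closed by (auto simp: subset_iff)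
    then show "H \<subseteq> coset h" unfolding left_coset_def by blast
  qed
  then show ?thesis
    using translate_coset[OF assms(1) h] by (simp add: left_coset_def)
qed

lemma coset_eqD:
  assumes "a \<in> G" "coset a = coset b"
  obtains h where "h \<in> H" "a = b \<oplus> h"
proof -
  have "a \<oplus> \<zero> \<in> coset a" using sub_zero_closed by (simp add: left_coset_def)
  then show ?thesis using assms zero_identity that by (auto simp: left_coset_def)
qed

lemma translate_cancel:
  assumes "a \<in> G" "b \<in> G"
  shows "add a ` (add (\<ominus> a) ` coset b) = coset b"
  using assms by (simp add: translate_coset neg_closed add_closed add_neg_cancel)

end

section \<open>Topology of the coset space: open projection and regularity\<close>

locale gyro_coset_space =
  strongly_topological_gyrogroup T add zero neg gyr +
  strong_subgyrogroup "topspace T" add zero neg gyr H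
  for T :: "'a topology"
    and add (infixl "\<oplus>" 65) and zero ("\<zero>") and neg ("\<ominus> _" [81] 80) and gyr and H
begin

abbreviation X :: "'a set topology" where
  "X \<equiv> coset_space T add H"

abbreviation G :: "'a set" where
  "G \<equiv> topspace T"

lemma in_topspace_X: "x \<in> topspace X \<longleftrightarrow> (\<exists>a\<in>G. x = coset a)"
  by (auto simp: topspace_coset_space)

lemma coset_in_topspace: "a \<in> G \<Longrightarrow> coset a \<in> topspace X"
  by (simp add: topspace_coset_space)

lemma continuous_coset: "continuous_map T X coset"
  by (rule quotient_imp_continuous_map[OF quotient_map_coset_space])

lemma continuous_add2:
  assumes "continuous_map Y T f" "continuous_map Y T g"
  shows "continuous_map Y T (\<lambda>y. f y \<oplus> g y)"
  using continuous_map_compose[OF continuous_map_pairedI[OF assms] continuous_add]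
  by (simp add: o_def)

lemma continuous_translate_gyro: "g \<in> G \<Longrightarrow> continuous_map T T (add g)"
  using continuous_add2[of T "\<lambda>_. g" "\<lambda>x. x"] by simp

text \<open>The saturation of \<open>U\<close> is the union, over \<open>h\<close> in
  \<open>H\<close>, of its preimages under the continuous right translations by
  \<open>h\<close>.\<close>

lemma open_coset_map:
  assumes "openin T U"
  shows "openin X (coset ` U)"
proof -
  have U: "U \<subseteq> G" using assms openin_subset by blast
  have "{b \<in> G. coset b \<in> coset ` U} = (\<Union>h\<in>H. {b \<in> G. b \<oplus> h \<in> U})"
  proof (intro equalityI subsetI)
    fix b assume "b \<in> {b \<in> G. coset b \<in> coset ` U}"
    then obtain a where a: "b \<in> G" "a \<in> U" "coset a = coset b" by auto
    moreover obtain h where "h \<in> H" "a = b \<oplus> h"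
      using coset_eqD[of a b] a U by blast
    ultimately show "b \<in> (\<Union>h\<in>H. {b \<in> G. b \<oplus> h \<in> U})" by blast
  next
    fix b assume "b \<in> (\<Union>h\<in>H. {b \<in> G. b \<oplus> h \<in> U})"
    then obtain h where "h \<in> H" "b \<in> G" "b \<oplus> h \<in> U" by blast
    moreover from this have "coset b = coset (b \<oplus> h)" using coset_absorb[of b h] by simp
    ultimately show "b \<in> {b \<in> G. coset b \<in> coset ` U}" by simp
  qed
  moreover have "openin T {b \<in> G. b \<oplus> h \<in> U}" if "h \<in> H" for h
    using continuous_add2[of T "\<lambda>x. x" "\<lambda>_. h"] that sub_subset assms
    by (intro openin_continuous_map_preimage[of T T]) auto
  ultimately show ?thesis
    unfolding openin_coset_space using U by auto
qed

lemma continuous_translate: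
  assumes g: "g \<in> G"
  shows "continuous_map X X (image (add g))"
proof (rule continuous_compose_quotient_map[OF quotient_map_coset_space])
  have "continuous_map T X (\<lambda>a. coset (g \<oplus> a))"
    using continuous_map_compose[OF continuous_translate_gyro[OF g] continuous_coset]
    by (simp add: o_def)
  then show "continuous_map T X (image (add g) \<circ> coset)"
    by (rule continuous_map_eq) (simp add: translate_coset g)
qed

text \<open>
  The only use of the gyration-invariant base: if \<open>U\<close> is gyration invariant, then
  \<open>a \<oplus> (\<ominus> b \<oplus> v) \<in> (a \<oplus> \<ominus> b) \<oplus> U\<close> for \<open>v \<in> U\<close>, uniformly in \<open>a\<close>.
\<close>

lemma closed_neighbourhood_zero:
  assumes W: "openin X W" "coset \<zero> \<in> W"
  obtains N D where "openin X N" "closedin X D" "coset \<zero> \<in> N" "N \<subseteq> D" "D \<subseteq> W"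
proof -
  obtain \<U> where base: "neighbourhood_base T \<zero> \<U>"
    and inv: "\<forall>U\<in>\<U>. \<forall>x\<in>G. \<forall>y\<in>G. gyr x y ` U = U"
    using gyr_invariant_base by blast
  let ?E = "{p \<in> topspace (prod_topology T T). coset (fst p \<oplus> snd p) \<in> W}"
  have "continuous_map (prod_topology T T) X (\<lambda>p. coset (fst p \<oplus> snd p))"
    using continuous_map_compose[OF continuous_add continuous_coset]
    by (simp add: o_def case_prod_unfold)
  then have "openin (prod_topology T T) ?E"
    using W(1) by (rule openin_continuous_map_preimage)
  moreover have "(\<zero>, \<zero>) \<in> ?E"
    using W(2) zero_closed zero_identity by simp
  ultimately obtain O1 O2 where O12: "openin T O1" "openin T O2" "\<zero> \<in> O1" "\<zero> \<in> O2" "O1 \<times> O2 \<subseteq> ?E"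
    by (rule openin_prod_box)
  have base': "\<exists>U\<in>\<U>. U \<subseteq> O2" "\<forall>U\<in>\<U>. \<exists>V. openin T V \<and> \<zero> \<in> V \<and> V \<subseteq> U"
    using base O12 by (simp_all add: neighbourhood_base_def)
  \<comment> \<open>Base members need not be open: \<open>U\<close> carries the gyration invariance,
    while the open \<open>V\<close> inside it has an open image in \<open>X\<close>.\<close>
  obtain U where U: "U \<in> \<U>" "U \<subseteq> O2" using base'(1) by blast
  then obtain V where V: "openin T V" "\<zero> \<in> V" "V \<subseteq> U" using base'(2) by blast
  have "X closure_of (coset ` V) \<subseteq> W"
  proof
    fix y assume y: "y \<in> X closure_of (coset ` V)"
    then have "y \<in> topspace X" by (simp add: in_closure_of)
    then obtain a where a: "a \<in> G" "y = coset a"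
      using in_topspace_X by blast
    \<comment> \<open>The image of \<open>?B\<close> is a neighbourhood of \<open>y\<close>, so it
      meets the image of \<open>V\<close>.\<close>
    let ?B = "{b \<in> G. a \<oplus> \<ominus> b \<in> O1}"
    have "openin T ?B"
      using continuous_add2[of T "\<lambda>_. a" "\<lambda>b. \<ominus> b"] continuous_neg a O12(1)
      by (intro openin_continuous_map_preimage[of T T]) auto
    moreover have "a \<in> ?B" using a O12 neg_inverse by simp
    ultimately have "openin X (coset ` ?B)" "y \<in> coset ` ?B"
      using open_coset_map a by blast+
    then have "\<exists>z. z \<in> coset ` V \<and> z \<in> coset ` ?B"
      by (intro y[unfolded in_closure_of, THEN conjunct2, THEN spec, THEN mp, OF conjI])
    then obtain b v where b: "b \<in> ?B" and v: "v \<in> V" and eq: "coset b = coset v"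
      by (elim exE conjE imageE) simp
    have "V \<subseteq> G" using V(1) by (rule openin_subset)
    then have mem: "b \<in> G" "v \<in> G" "\<ominus> b \<in> G" "a \<oplus> \<ominus> b \<in> G" "gyr a (\<ominus> b) v \<in> G"
      using b v a by (auto intro!: neg_closed add_closed gyr_closed)
    \<comment> \<open>From \<open>coset b = coset v\<close>, the coset of \<open>a\<close> is that
      of \<open>a \<oplus> (\<ominus> b \<oplus> v)\<close>, that is, of
      \<open>(a \<oplus> \<ominus> b) \<oplus> gyr a (\<ominus> b) v\<close>, whose summands lie in
      \<open>O1\<close> and \<open>O2\<close>.\<close>
    have "gyr a (\<ominus> b) v \<in> O2"
      using inv[rule_format, OF U(1) a(1) mem(3)] v V(3) U(2) by blast
    then have "coset ((a \<oplus> \<ominus> b) \<oplus> gyr a (\<ominus> b) v) \<in> W"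
      using b O12(5) by force
    moreover have "coset ((a \<oplus> \<ominus> b) \<oplus> gyr a (\<ominus> b) v) = add a ` (add (\<ominus> b) ` coset v)"
      using a mem by (simp add: translate_coset add_closed gyr_assoc)
    moreover have "add a ` (add (\<ominus> b) ` coset b) = coset a"
      using a mem neg_inverse zero_identity zero_closed by (simp add: translate_coset)
    ultimately show "y \<in> W" using a eq by simp
  qed
  moreover have "openin X (coset ` V)" using V open_coset_map by blast
  moreover from this have "coset ` V \<subseteq> X closure_of (coset ` V)"
    by (intro closure_of_subset openin_subset)
  ultimately show thesis
    using V(2) by (intro that[of "coset ` V" "X closure_of (coset ` V)"]) auto
qed

text \<open>Regularity at the coset of zero is carried to \<open>coset c\<close> by translation: the
  neighbourhood is moved back by \<open>c\<close>, shrunk there, and pulled back along the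
  translation by \<open>\<ominus> c\<close>.\<close>

lemma regular_space_coset: "regular_space X"
  unfolding neighbourhood_base_of_closedin[symmetric] neighbourhood_base_of
proof (intro allI impI)
  fix W x assume W: "openin X W \<and> x \<in> W"
  then obtain c where c: "c \<in> G" "x = coset c"
    using openin_subset in_topspace_X by blast
  let ?W = "{y \<in> topspace X. add c ` y \<in> W}"
  have "openin X ?W"
    using continuous_translate[OF c(1)] W by (intro openin_continuous_map_preimage) auto
  moreover have "coset \<zero> \<in> ?W"
    using W c zero_closed zero_identity translate_coset by (auto simp: coset_in_topspace)
  ultimately obtain N D where ND: "openin X N" "closedin X D" "coset \<zero> \<in> N" "N \<subseteq> D" "D \<subseteq> ?W"
    by (rule closed_neighbourhood_zero)
  let ?m = "image (add (\<ominus> c))"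
  have m: "continuous_map X X ?m" using c neg_closed continuous_translate by blast
  have "openin X {y \<in> topspace X. ?m y \<in> N}" "closedin X {y \<in> topspace X. ?m y \<in> D}"
    using m ND openin_continuous_map_preimage closedin_continuous_map_preimage by blast+
  moreover have "x \<in> {y \<in> topspace X. ?m y \<in> N}"
    using c ND(3) by (simp add: coset_in_topspace translate_coset neg_closed neg_inverse)
  moreover have "{y \<in> topspace X. ?m y \<in> D} \<subseteq> W"
  proof
    fix y assume y: "y \<in> {y \<in> topspace X. ?m y \<in> D}"
    then have "add c ` (?m y) \<in> W" using ND(5) by blast
    then show "y \<in> W" using y c translate_cancel by (auto simp: in_topspace_X)
  qed
  ultimately show "\<exists>U V. openin X U \<and> closedin X V \<and> x \<in> U \<and> U \<subseteq> V \<and> V \<subseteq> W"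
    using ND(4) by (intro exI[of _ "{y \<in> topspace X. ?m y \<in> N}"] exI[of _ "{y \<in> topspace X. ?m y \<in> D}"]) auto
qed

section \<open>Countable invariant families and openness of hulls\<close>

definition translation_invariant :: "('a set \<Rightarrow> real) set \<Rightarrow> bool" where
  "translation_invariant S \<longleftrightarrow> (\<forall>x\<in>topspace X. \<forall>y\<in>topspace X. (\<forall>s\<in>S. s x = s y) \<longrightarrow>
     (\<forall>g\<in>G. \<forall>s\<in>S. s (add g ` x) = s (add g ` y)))"

text \<open>
  The countable family consists of the \<open>h\<close> occurring in countable covers of \<open>T \<times> T\<close> by boxes
  \<open>V \<times> {a. h (coset a) \<noteq> 0}\<close> on which \<open>(g, a) \<mapsto> f (coset (g \<oplus> a))\<close> oscillates by less than \<open>1 / n\<close>.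
\<close>

lemma countable_control:
  assumes L: "Lindelof_space (prod_topology T T)"
    and cr: "completely_regular_space X"
    and f: "continuous_map X euclideanreal f"
  shows "\<exists>N. countable N \<and> (\<forall>h\<in>N. continuous_map X euclideanreal h) \<and>
    (\<forall>x\<in>topspace X. \<forall>y\<in>topspace X. \<forall>g\<in>G. (\<forall>h\<in>N. h x = h y) \<longrightarrow> f (add g ` x) = f (add g ` y))"
proof -
  define F where "F g x = f (add g ` x)" for g x
  have F_cont: "continuous_map (prod_topology T T) euclideanreal (\<lambda>p. F (fst p) (coset (snd p)))"
  proof (rule continuous_map_eq)
    show "continuous_map (prod_topology T T) euclideanreal (\<lambda>p. f (coset (fst p \<oplus> snd p)))"
      using continuous_map_compose[OF continuous_map_compose[OF continuous_add continuous_coset] f]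
      by (simp add: o_def case_prod_unfold)
  qed (auto simp: F_def translate_coset)
  define box where "box V h = {p \<in> topspace (prod_topology T T). fst p \<in> V \<and> h (coset (snd p)) \<noteq> (0::real)}"
    for V h
  define small where "small e V h \<longleftrightarrow> openin T V \<and> continuous_map X euclideanreal h \<and>
      (\<forall>v\<in>V. \<forall>v'\<in>V. \<forall>x\<in>topspace X. \<forall>y\<in>topspace X. h x \<noteq> 0 \<longrightarrow> h y \<noteq> 0 \<longrightarrow> \<bar>F v x - F v' y\<bar> < e)"
    for e V h
  have small_ex: "\<exists>V h. small e V h \<and> (g, a) \<in> box V h" if ga: "g \<in> G" "a \<in> G" and e: "e > 0" for g a e
  proof -
    let ?E = "{p \<in> topspace (prod_topology T T). \<bar>F g (coset a) - F (fst p) (coset (snd p))\<bar> < e / 2}"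
    have "openin (prod_topology T T) ?E" by (rule openin_real_near[OF F_cont])
    moreover have "(g, a) \<in> ?E" using ga e by simp
    ultimately obtain V W where VW: "openin T V" "openin T W" "g \<in> V" "a \<in> W" "V \<times> W \<subseteq> ?E"
      by (rule openin_prod_box)
    \<comment> \<open>A cozero set is fitted inside the image of \<open>W\<close>:
      \<open>1 - k\<close> equals 1 at \<open>coset a\<close> and vanishes off that image.\<close>
    have "\<exists>k. continuous_map X euclideanreal k \<and> k (coset a) = 0 \<and> k ` (topspace X - coset ` W) \<subseteq> {1}"
      using open_coset_map[OF VW(2)] VW(4)
      by (intro cr[unfolded completely_regular_space_alt', rule_format]) auto
    then obtain k where k: "continuous_map X euclideanreal k" "k (coset a) = 0"
        "k ` (topspace X - coset ` W) \<subseteq> {1}"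
      by blast
    have "small e V (\<lambda>x. 1 - k x)"
      unfolding small_def
    proof (intro conjI ballI impI)
      show "continuous_map X euclideanreal (\<lambda>x. 1 - k x)"
        by (intro continuous_map_diff k) simp
      fix v v' x y assume *: "v \<in> V" "v' \<in> V" "x \<in> topspace X" "y \<in> topspace X" "1 - k x \<noteq> 0" "1 - k y \<noteq> 0"
      then have "x \<in> coset ` W" "y \<in> coset ` W" using k(3) by force+
      then obtain b c where bc: "b \<in> W" "c \<in> W" "x = coset b" "y = coset c" by blast
      then have "(v, b) \<in> ?E" "(v', c) \<in> ?E" using * VW(5) by blast+
      then have "\<bar>F g (coset a) - F v x\<bar> < e / 2" "\<bar>F g (coset a) - F v' y\<bar> < e / 2"
        using bc by simp_all
      then show "\<bar>F v x - F v' y\<bar> < e" by linarith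
    qed (rule VW(1))
    moreover have "(g, a) \<in> box V (\<lambda>x. 1 - k x)"
      using ga VW(3) k(2) by (simp add: box_def)
    ultimately show ?thesis by blast
  qed
  have box_open: "openin (prod_topology T T) (box V h)" if "small e V h" for e V h
  proof -
    have h: "continuous_map (prod_topology T T) euclideanreal (\<lambda>p. h (coset (snd p)))"
      using that continuous_map_compose[OF continuous_map_compose[OF continuous_map_snd continuous_coset], of euclideanreal h T]
      by (simp add: o_def small_def)
    have "box V h = {p \<in> topspace (prod_topology T T). fst p \<in> V} \<inter>
        {p \<in> topspace (prod_topology T T). h (coset (snd p)) \<in> - {0}}"
      by (auto simp: box_def)
    moreover have "openin (prod_topology T T) {p \<in> topspace (prod_topology T T). fst p \<in> V}"
      by (rule openin_continuous_map_preimage[OF continuous_map_fst]) (use that in \<open>simp add: small_def\<close>)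
    moreover have "openin (prod_topology T T) {p \<in> topspace (prod_topology T T). h (coset (snd p)) \<in> - {0}}"
      by (rule openin_continuous_map_preimage[OF h]) auto
    ultimately show ?thesis by (simp only: openin_Int)
  qed
  have cover: "\<exists>N. countable N \<and> (\<forall>h\<in>N. continuous_map X euclideanreal h) \<and>
      (\<forall>g\<in>G. \<forall>a\<in>G. \<exists>V. \<exists>h\<in>N. small e V h \<and> (g, a) \<in> box V h)" if e: "e > 0" for e
  proof -
    define \<B> where "\<B> = {box V h | V h. small e V h}"
    have "\<forall>B\<in>\<B>. openin (prod_topology T T) B" using box_open by (auto simp: \<B>_def)
    moreover have "topspace (prod_topology T T) \<subseteq> \<Union>\<B>"
    proof
      fix p assume "p \<in> topspace (prod_topology T T)"
      then obtain g a where "p = (g, a)" "g \<in> G" "a \<in> G" by auto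
      then show "p \<in> \<Union>\<B>" using small_ex[of g a, OF _ _ e] unfolding \<B>_def by blast
    qed
    ultimately obtain \<V> where \<V>: "countable \<V>" "\<V> \<subseteq> \<B>" "topspace (prod_topology T T) \<subseteq> \<Union>\<V>"
      using L unfolding Lindelof_space_alt by meson
    have "\<forall>B\<in>\<V>. \<exists>h. \<exists>V. small e V h \<and> B = box V h" using \<V>(2) unfolding \<B>_def by blast
    then obtain hh where hh: "\<forall>B\<in>\<V>. \<exists>V. small e V (hh B) \<and> B = box V (hh B)"
      by (rule bchoice[THEN exE])
    have "\<exists>V. \<exists>h\<in>hh ` \<V>. small e V h \<and> (g, a) \<in> box V h" if "g \<in> G" "a \<in> G" for g a
    proof -
      have "(g, a) \<in> topspace (prod_topology T T)" using that by simp
      then obtain B where "B \<in> \<V>" "(g, a) \<in> B" using \<V>(3) by blast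
      then show ?thesis using hh by blast
    qed
    moreover have "\<forall>h\<in>hh ` \<V>. continuous_map X euclideanreal h"
      using hh by (auto simp: small_def)
    ultimately show ?thesis using \<V>(1) by (intro exI[of _ "hh ` \<V>"]) auto
  qed
  have "\<forall>n. \<exists>N. countable N \<and> (\<forall>h\<in>N. continuous_map X euclideanreal h) \<and>
      (\<forall>g\<in>G. \<forall>a\<in>G. \<exists>V. \<exists>h\<in>N. small (1 / real (Suc n)) V h \<and> (g, a) \<in> box V h)"
    using cover by simp
  then obtain N where N: "\<forall>n. countable (N n) \<and> (\<forall>h\<in>N n. continuous_map X euclideanreal h) \<and>
      (\<forall>g\<in>G. \<forall>a\<in>G. \<exists>V. \<exists>h\<in>N n. small (1 / real (Suc n)) V h \<and> (g, a) \<in> box V h)"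
    by (rule choice[THEN exE])
  show ?thesis
  proof (intro exI[of _ "\<Union>n. N n"] conjI ballI impI)
    show "countable (\<Union>n. N n)" using N by blast
    show "continuous_map X euclideanreal h" if "h \<in> (\<Union>n. N n)" for h using N that by blast
    fix x y g assume xy: "x \<in> topspace X" "y \<in> topspace X" and g: "g \<in> G" and eq: "\<forall>h\<in>(\<Union>n. N n). h x = h y"
    obtain a where a: "a \<in> G" "x = coset a" using xy in_topspace_X by blast
    have "\<bar>F g x - F g y\<bar> < 1 / real (Suc n)" for n
    proof -
      obtain V h where h: "h \<in> N n" "small (1 / real (Suc n)) V h" "(g, a) \<in> box V h"
        using N g a by blast
      then have "h x \<noteq> 0" "g \<in> V" using a by (auto simp: box_def)
      \<comment> \<open>Agreement under \<open>h\<close> makes \<open>h y\<close> nonzero too, so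
        \<open>x\<close> and \<open>y\<close> lie in one cozero set and \<open>small\<close> applies
        with \<open>v = v' = g\<close>.\<close>
      moreover have "h x = h y" using eq h(1) by blast
      ultimately show ?thesis using h(2) xy unfolding small_def by metis
    qed
    then have "\<bar>F g x - F g y\<bar> \<le> 0"
      by (metis linorder_not_less nat_approx_posE order_less_asym)
    then show "f (add g ` x) = f (add g ` y)" by (simp add: F_def)
  qed
qed

text \<open>Closing off in countably many steps: the functions controlling a member of
  \<open>R n\<close> all appear in \<open>R (Suc n)\<close>, so agreement under the union controls
  the translates of each member.\<close>

lemma countable_invariant_closure:
  assumes L: "Lindelof_space (prod_topology T T)"
    and cr: "completely_regular_space X"
    and S0: "countable S0" "\<And>s. s \<in> S0 \<Longrightarrow> continuous_map X euclideanreal s"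
  shows "\<exists>S. S0 \<subseteq> S \<and> countable S \<and> (\<forall>s\<in>S. continuous_map X euclideanreal s) \<and>
    translation_invariant S"
proof -
  define controls where "controls N f \<longleftrightarrow> countable N \<and> (\<forall>h\<in>N. continuous_map X euclideanreal h) \<and>
    (\<forall>x\<in>topspace X. \<forall>y\<in>topspace X. \<forall>g\<in>G. (\<forall>h\<in>N. h x = h y) \<longrightarrow> f (add g ` x) = f (add g ` y))"
    for N and f :: "'a set \<Rightarrow> real"
  have "\<forall>f\<in>{f. continuous_map X euclideanreal f}. \<exists>N. controls N f"
    unfolding controls_def using countable_control[OF L cr] by blast
  then obtain N where N: "\<forall>f\<in>{f. continuous_map X euclideanreal f}. controls (N f) f"
    by (rule bchoice[THEN exE])
  define R where "R = rec_nat S0 (\<lambda>_ A. \<Union>f\<in>A. N f)"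
  have R: "R 0 = S0" "R (Suc n) = (\<Union>f\<in>R n. N f)" for n
    by (simp_all add: R_def)
  have R_cont: "countable (R n) \<and> (\<forall>s\<in>R n. continuous_map X euclideanreal s)" for n
  proof (induction n)
    case 0 then show ?case using S0 R by auto
  next
    case (Suc n)
    then have "controls (N f) f" if "f \<in> R n" for f using N that by blast
    then have "\<forall>f\<in>R n. countable (N f)" "\<forall>f\<in>R n. \<forall>s\<in>N f. continuous_map X euclideanreal s"
      unfolding controls_def by blast+
    then show ?case using Suc unfolding R(2) by (intro conjI countable_UN) auto
  qed
  show ?thesis
  proof (intro exI[of _ "\<Union>n. R n"] conjI ballI)
    show "S0 \<subseteq> (\<Union>n. R n)" using R(1) by blast
    show "countable (\<Union>n. R n)" using R_cont by blast
    show "continuous_map X euclideanreal s" if "s \<in> (\<Union>n. R n)" for s using R_cont that by blast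
    show "translation_invariant (\<Union>n. R n)"
      unfolding translation_invariant_def
    proof (intro ballI impI)
      fix x y g s assume xy: "x \<in> topspace X" "y \<in> topspace X" and g: "g \<in> G"
        and eq: "\<forall>s\<in>(\<Union>n. R n). s x = s y" and "s \<in> (\<Union>n. R n)"
      then obtain n where s: "s \<in> R n" by blast
      then have "N s \<subseteq> R (Suc n)" using R(2) by blast
      then have "\<forall>h\<in>N s. h x = h y" using eq by blast
      moreover have "controls (N s) s" using N R_cont s by blast
      ultimately show "s (add g ` x) = s (add g ` y)" using xy g unfolding controls_def by blast
    qed
  qed
qed

lemma translation_invariant_Union:
  assumes "\<And>S. S \<in> \<S> \<Longrightarrow> translation_invariant S"
  shows "translation_invariant (\<Union>\<S>)"
  unfolding translation_invariant_def
proof (intro ballI impI)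
  fix x y g s
  assume *: "x \<in> topspace X" "y \<in> topspace X" "\<forall>s\<in>\<Union>\<S>. s x = s y" "g \<in> G" "s \<in> \<Union>\<S>"
  then obtain S where S: "S \<in> \<S>" "s \<in> S" by blast
  then have "\<forall>s\<in>S. s x = s y" using *(3) by blast
  then show "s (add g ` x) = s (add g ` y)"
    using assms[OF S(1)] * S(2) unfolding translation_invariant_def by blast
qed

text \<open>
  With \<open>y = coset a\<close>, the Mal'tsev-like map \<open>b \<mapsto> b (\<ominus>a x)\<close> sends \<open>a\<close> to \<open>x\<close>, and its values are
  \<open>S\<close>-equivalent to \<open>coset b\<close> whenever \<open>x\<close> is \<open>S\<close>-equivalent to \<open>y\<close>.
\<close>

lemma invariant_hull_open:
  assumes inv: "translation_invariant S" and K: "K \<subseteq> topspace X"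
    and sat: "\<And>x y. \<lbrakk>x \<in> K; y \<in> topspace X; \<forall>s\<in>S. s x = s y\<rbrakk> \<Longrightarrow> y \<in> K"
    and U: "openin (subtopology X K) U"
  shows "openin (subtopology X K) {y \<in> K. \<exists>x\<in>U. \<forall>s\<in>S. s x = s y}"
  unfolding openin_subopen[of "subtopology X K" "{y \<in> K. \<exists>x\<in>U. \<forall>s\<in>S. s x = s y}"]
proof
  fix y assume "y \<in> {y \<in> K. \<exists>x\<in>U. \<forall>s\<in>S. s x = s y}"
  then obtain x where y: "y \<in> K" and x: "x \<in> U" and xy: "\<forall>s\<in>S. s x = s y" by blast
  obtain W where W: "openin X W" "U = W \<inter> K"
    using U unfolding openin_subtopology by blast
  have xX: "x \<in> topspace X" and yX: "y \<in> topspace X" using x y W K by auto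
  then obtain a e where a: "a \<in> G" "y = coset a" and e: "e \<in> G" "x = coset e"
    using in_topspace_X by metis
  \<comment> \<open>Since \<open>a \<oplus> ?d = e\<close>, right translation by \<open>?d\<close>
    takes the representative of \<open>y\<close> to that of \<open>x\<close>; continuity in
    \<open>b\<close> then yields points of \<open>W\<close> over a neighbourhood of
    \<open>y\<close>.\<close>
  let ?d = "\<ominus> a \<oplus> e"
  have d: "?d \<in> G" using a e neg_closed add_closed by simp
  let ?B = "{b \<in> G. coset (b \<oplus> ?d) \<in> W}"
  have "continuous_map T X (\<lambda>b. coset (b \<oplus> ?d))"
    using continuous_map_compose[OF continuous_add2[of T "\<lambda>b. b" "\<lambda>_. ?d"] continuous_coset] d
    by (simp add: o_def)
  then have B: "openin T ?B" using W(1) by (rule openin_continuous_map_preimage)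
  have "a \<in> ?B" using a e x W add_neg_cancel by simp
  moreover have "coset ` ?B \<inter> K \<subseteq> {y \<in> K. \<exists>x\<in>U. \<forall>s\<in>S. s x = s y}"
  proof
    fix y' assume y': "y' \<in> coset ` ?B \<inter> K"
    then obtain b where b: "b \<in> G" "coset (b \<oplus> ?d) \<in> W" "y' = coset b" by blast
    let ?x = "coset (b \<oplus> ?d)"
    have na: "\<ominus> a \<in> G" using a neg_closed by simp
    have x1: "?x = add b ` (add (\<ominus> a) ` x)"
      using a b d e na by (simp add: translate_coset)
    have y1: "y' = add b ` (add (\<ominus> a) ` y)"
      using a b na neg_inverse zero_identity zero_closed by (simp add: translate_coset)
    have "add (\<ominus> a) ` x \<in> topspace X" "add (\<ominus> a) ` y \<in> topspace X"
      using a e na by (auto simp: translate_coset coset_in_topspace add_closed)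
    \<comment> \<open>Invariance is applied twice, for \<open>\<ominus> a\<close> and then for
      \<open>b\<close>, in keeping with the order of the two translations.\<close>
    moreover have "\<forall>s\<in>S. s (add (\<ominus> a) ` x) = s (add (\<ominus> a) ` y)"
      using inv xy xX yX na unfolding translation_invariant_def by blast
    ultimately have eq: "\<forall>s\<in>S. s ?x = s y'"
      using inv b(1) unfolding translation_invariant_def x1 y1 by blast
    \<comment> \<open>Saturation brings the translated point back into \<open>K\<close>, hence into
      \<open>U = W \<inter> K\<close>.\<close>
    then have "?x \<in> K"
      using y' b d by (intro sat[of y' ?x]) (auto simp: coset_in_topspace add_closed)
    then show "y' \<in> {y \<in> K. \<exists>x\<in>U. \<forall>s\<in>S. s x = s y}"
      using y' b eq W by blast
  qed
  moreover have "openin (subtopology X K) (coset ` ?B \<inter> K)"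
    using open_coset_map[OF B] unfolding openin_subtopology by blast
  ultimately show "\<exists>V. openin (subtopology X K) V \<and> y \<in> V \<and> V \<subseteq> {y \<in> K. \<exists>x\<in>U. \<forall>s\<in>S. s x = s y}"
    using a y by (intro exI[of _ "coset ` ?B \<inter> K"]) blast
qed

end

section \<open>Saturation of closed \<open>G\<^sub>\<delta>\<close>-sets and the final
  assembly\<close>

text \<open>For each open set \<open>W\<close> of a countable family with intersection
  \<open>K\<close>, take a Urysohn function that is 0 on \<open>K\<close> and 1 off
  \<open>W\<close>. A point agreeing with a point of \<open>K\<close> under all of them lies in
  every \<open>W\<close>.\<close>

lemma gdelta_saturating_functions:
  assumes "normal_space X" "closedin X K" "gdelta_in X K"
  obtains S where "countable S" "\<And>s. s \<in> S \<Longrightarrow> continuous_map X euclideanreal s"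
    "\<And>x y. \<lbrakk>x \<in> K; y \<in> topspace X; \<forall>s\<in>S. s x = s y\<rbrakk> \<Longrightarrow> y \<in> K"
proof -
  obtain \<O> where \<O>: "countable \<O>" "\<And>W. W \<in> \<O> \<Longrightarrow> openin X W" "\<Inter>\<O> = K"
    using assms(3) unfolding gdelta_in_alt intersection_of_def by (auto simp: subset_eq)
  have "\<forall>W\<in>\<O>. \<exists>s. continuous_map X euclideanreal s \<and> s ` K \<subseteq> {0::real} \<and> s ` (topspace X - W) \<subseteq> {1}"
  proof
    fix W assume W: "W \<in> \<O>"
    then have "closedin X (topspace X - W)" "disjnt K (topspace X - W)"
      using \<O>(2) \<O>(3) by (auto simp: disjnt_def)
    then show "\<exists>s. continuous_map X euclideanreal s \<and> s ` K \<subseteq> {0::real} \<and> s ` (topspace X - W) \<subseteq> {1}"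
      using Urysohn_lemma_alt[OF assms(1,2)] by metis
  qed
  then obtain s where s: "\<forall>W\<in>\<O>. continuous_map X euclideanreal (s W) \<and> s W ` K \<subseteq> {0::real} \<and>
      s W ` (topspace X - W) \<subseteq> {1}"
    by (rule bchoice[THEN exE])
  show thesis
  proof
    show "countable (s ` \<O>)" using \<O>(1) by simp
    show "continuous_map X euclideanreal f" if "f \<in> s ` \<O>" for f using s that by blast
    show "y \<in> K" if "x \<in> K" "y \<in> topspace X" "\<forall>f\<in>s ` \<O>. f x = f y" for x y
    proof -
      have "y \<in> W" if W: "W \<in> \<O>" for W
      proof (rule ccontr)
        assume "y \<notin> W"
        then have "s W y = 1" "s W x = 0" using s W \<open>x \<in> K\<close> \<open>y \<in> topspace X\<close> by blast+
        then show False using \<open>\<forall>f\<in>s ` \<O>. f x = f y\<close> W by simp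
      qed
      then show ?thesis using \<O>(3) by blast
    qed
  qed
qed

theorem theorem4p5:
  fixes \<L> :: "'a topology set"
    and T :: "'a topology"
    and add :: "'a \<Rightarrow> 'a \<Rightarrow> 'a"
    and zero :: 'a
    and neg :: "'a \<Rightarrow> 'a"
    and gyr :: "'a \<Rightarrow> 'a \<Rightarrow> 'a \<Rightarrow> 'a"
    and H :: "'a set"
    and K :: "'a set set"
  assumes "productive_Lindelof_class \<L>"
    and "T \<in> \<L>"
    and "strongly_topological_gyrogroup T add zero neg gyr"
    and "strong_subgyrogroup (topspace T) add zero neg gyr H"
    and "Hausdorff_space (coset_space T add H)"
    and "compactin (coset_space T add H) K"
    and "gdelta_in (coset_space T add H) K"
    and "K \<noteq> {}"
  shows "Dugundji_space TYPE('z) (subtopology (coset_space T add H) K)"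
proof -
  interpret gyro_coset_space T add zero neg gyr H
    using assms(3,4) by (rule gyro_coset_space.intro)
  have "Lindelof_space T" using assms(1,2) by (simp add: productive_Lindelof_class_def)
  \<comment> \<open>The class contains the square of \<open>T\<close> only up to homeomorphism, so
    the Lindelof property is transferred along a quotient map.\<close>
  obtain P where "P \<in> \<L>" "P homeomorphic_space prod_topology T T"
    using assms(1,2) unfolding productive_Lindelof_class_def by blast
  then obtain f where "quotient_map P (prod_topology T T) f" "Lindelof_space P"
    using assms(1) unfolding productive_Lindelof_class_def homeomorphic_space homeomorphic_map_def by blast
  then have L: "Lindelof_space (prod_topology T T)"
    by (rule Lindelof_space_quotient_map_image)
  have "Lindelof_space X"
    using Lindelof_space_quotient_map_image[OF quotient_map_coset_space \<open>Lindelof_space T\<close>] .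
  then have normal: "normal_space X"
    using regular_space_coset regular_Lindelof_imp_normal_space by blast
  have cr: "completely_regular_space X"
    using normal assms(5) normal_imp_completely_regular_space by blast
  have K: "closedin X K" "K \<subseteq> topspace X"
    using assms(5,6) compactin_imp_closedin compactin_subset_topspace by blast+
  obtain S0 where S0: "countable S0" "\<And>s. s \<in> S0 \<Longrightarrow> continuous_map X euclideanreal s"
    "\<And>x y. \<lbrakk>x \<in> K; y \<in> topspace X; \<forall>s\<in>S0. s x = s y\<rbrakk> \<Longrightarrow> y \<in> K"
    using gdelta_saturating_functions[OF normal K(1) assms(7)] by metis
  \<comment> \<open>The functions live on all of \<open>X\<close> and not on \<open>K\<close>, since
    translations may move points out of \<open>K\<close>.\<close>
  define C where "C = {s :: 'a set \<Rightarrow> real. continuous_map X euclideanreal s}"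
  define good where "good S \<longleftrightarrow> S = {} \<or> S0 \<subseteq> S \<and> translation_invariant S" for S
  have top: "topspace (subtopology X K) = K" using K(2) by auto
  show ?thesis
  proof (rule Dugundji_criterion[where C = C and good = good])
    show "compact_space (subtopology X K)" using assms(6) compactin_subspace by blast
    show "Hausdorff_space (subtopology X K)" using assms(5) Hausdorff_space_subtopology by blast
    show "topspace (subtopology X K) \<noteq> {}" using top assms(8) by simp
    show "continuous_map (subtopology X K) euclideanreal s" if "s \<in> C" for s
      using that by (simp add: C_def continuous_map_from_subtopology)
    show "\<exists>s\<in>C. s x = 0 \<and> (\<forall>y\<in>topspace (subtopology X K) - U. s y = 1)"
      if U: "openin (subtopology X K) U" "x \<in> U" for U x
    proof -
      obtain W where W: "openin X W" "U = W \<inter> K" using U unfolding openin_subtopology by blast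
      then have "\<exists>s. continuous_map X euclideanreal s \<and> s x = 0 \<and> s ` (topspace X - W) \<subseteq> {1}"
        using U(2) by (intro cr[unfolded completely_regular_space_alt', rule_format]) auto
      then obtain s where "continuous_map X euclideanreal s" "s x = 0" "s ` (topspace X - W) \<subseteq> {1}"
        by blast
      then show ?thesis using W K(2) by (intro bexI[of _ s]) (auto simp: C_def)
    qed
    show "openin (subtopology X K) {y \<in> topspace (subtopology X K). \<exists>x\<in>U. \<forall>s\<in>S. s x = s y}"
      if S: "good S" and U: "openin (subtopology X K) U" for S U
    proof (cases "S = {}")
      case True
      then have "{y \<in> topspace (subtopology X K). \<exists>x\<in>U. \<forall>s\<in>S. s x = s y} =
          (if U = {} then {} else topspace (subtopology X K))" by auto
      then show ?thesis
        by (cases "U = {}") (simp_all only: simp_thms if_True if_False openin_empty openin_topspace)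
    next
      case False
      then have S': "S0 \<subseteq> S" "translation_invariant S" using S by (auto simp: good_def)
      have sat: "y \<in> K" if "x \<in> K" "y \<in> topspace X" "\<forall>s\<in>S. s x = s y" for x y
        using S0(3)[of x y] that S'(1) by blast
      show ?thesis
        unfolding top by (rule invariant_hull_open[OF S'(2) K(2) sat U])
    qed
    show "good (\<Union>\<S>)" if \<S>: "\<And>S. S \<in> \<S> \<Longrightarrow> good S" for \<S>
    proof -
      have "translation_invariant S" if "S \<in> \<S>" for S
        using \<S>[OF that] by (auto simp: good_def translation_invariant_def)
      then have "translation_invariant (\<Union>\<S>)" by (rule translation_invariant_Union)
      then show ?thesis using \<S> unfolding good_def by blast
    qed
    show "\<exists>T\<subseteq>C. countable T \<and> s \<in> T \<and> good (S \<union> T)" if S: "good S" "s \<in> C" for S s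
    proof -
      \<comment> \<open>\<open>S0\<close> is included so that the enlarged family contains it even
        when \<open>S\<close> is empty.\<close>
      have "countable (insert s S0)" using S0(1) by simp
      moreover have "continuous_map X euclideanreal r" if "r \<in> insert s S0" for r
        using that S0(2) S(2) by (auto simp: C_def)
      ultimately obtain R where R: "insert s S0 \<subseteq> R" "countable R"
        "\<forall>s\<in>R. continuous_map X euclideanreal s" "translation_invariant R"
        using countable_invariant_closure[OF L cr, of "insert s S0"] by blast
      have "translation_invariant S" using S(1) by (auto simp: good_def translation_invariant_def)
      then have "translation_invariant (S \<union> R)"
        using translation_invariant_Union[of "{S, R}"] R(4) by auto
      then show ?thesis
        using R by (intro exI[of _ R]) (auto simp: C_def good_def)
    qed
  qed
qed

end
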